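(* Let $T$ be a tree on $n\geq 4$ vertices which is not the star $K_{1,n-1}$. Then $$\xi_2(T)\geq \xi_2(T_{n,3}^{0,n-4}),$$ with equality if and only if $T\cong T_{n,3}^{0,n-4}$.
   Context: For a connected graph $G$, the eccentricity matrix $\mathcal{E}(G)$ is the matrix indexed by $V(G)$ with $(u,v)$-entry $d_G(u,v)$ if $d_G(u,v)=\min\{e_G(u),e_G(v)\}$ and $0$ otherwise, where $d_G$ is the distance and $e_G(u)=\max_v d_G(u,v)$ the eccentricity. Its eigenvalues are ordered $\xi_1(G)\geq \xi_2(G)\geq\cdots$. $T_{n,3}^{0,n-4}$ is the tree obtained from the path $v_0v_1v_2v_3$ by attaching $n-4$ pendant vertices to $v_2$. *)

theory Defs
  imports
    "Graph_Theory.Graph_Theory"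
    "Jordan_Normal_Form.Char_Poly"
begin

text \<open>
  Simple graphs are the \<^locale>\<open>pair_graph\<close>s of the graph library: finite symmetric loop-free
  digraphs, with each edge represented by its two orientations.

  The library's \<^const>\<open>tree\<close> does not fit here: it counts the closed walk a, b, a as a cycle, so a
  symmetric digraph with an edge is never a \<^const>\<open>tree\<close>. In a simple graph, the cycles in the
  undirected sense are exactly the cycles in the library's sense of length at least 3.
\<close>

definition undirected_tree :: "'a pair_pre_digraph \<Rightarrow> bool" where
  "undirected_tree G \<longleftrightarrow>
     pair_graph G \<and> Digraph_Component.connected (with_proj G) \<and>
     \<not> (\<exists>p. pre_digraph.cycle (with_proj G) p \<and> 3 \<le> length p)"

definition gdist :: "'a pair_pre_digraph \<Rightarrow> 'a \<Rightarrow> 'a \<Rightarrow> nat" where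
  "gdist G u v = (LEAST k. \<exists>p. pre_digraph.apath (with_proj G) u p v \<and> length p = k)"

definition eccentricity :: "'a pair_pre_digraph \<Rightarrow> 'a \<Rightarrow> nat" where
  "eccentricity G u = Max (gdist G u ` pverts G)"

definition ecc_entry :: "'a pair_pre_digraph \<Rightarrow> 'a \<Rightarrow> 'a \<Rightarrow> real" where
  "ecc_entry G u v =
     (if gdist G u v = min (eccentricity G u) (eccentricity G v) then real (gdist G u v) else 0)"

text \<open>
  Matrices of the library are indexed by natural numbers, so the vertices have to be listed in some
  order. Which one is irrelevant to the spectrum, see \<open>char_poly_ecc_mat_cong\<close> below.
\<close>

definition ecc_mat :: "'a pair_pre_digraph \<Rightarrow> 'a list \<Rightarrow> real mat" where
  "ecc_mat G vs = mat (length vs) (length vs) (\<lambda>(i, j). ecc_entry G (vs ! i) (vs ! j))"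

definition eccentricity_matrix :: "'a pair_pre_digraph \<Rightarrow> real mat" where
  "eccentricity_matrix G = ecc_mat G (SOME vs. distinct vs \<and> set vs = pverts G)"

lemma char_poly_ecc_mat_cong:
  assumes "distinct vs" "distinct ws" "set vs = set ws"
  shows "char_poly (ecc_mat G vs) = char_poly (ecc_mat G ws)"
proof -
  define n where "n = length vs"
  have n: "length vs = n" "length ws = n"
    using assms by (simp_all add: n_def flip: distinct_card)
  define P :: "real mat" where "P = mat n n (\<lambda>(i, j). if vs ! i = ws ! j then 1 else 0)"
  define Q :: "real mat" where "Q = mat n n (\<lambda>(i, j). if ws ! i = vs ! j then 1 else 0)"
  have select: "(\<Sum>k<n. (if x = ys ! k then f (ys ! k) else 0)) = f x"
    if "distinct ys" "length ys = n" "x \<in> set ys" for x :: 'a and ys and f :: "'a \<Rightarrow> real"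
  proof -
    have "(\<Sum>k<n. (if x = ys ! k then f (ys ! k) else 0)) = (\<Sum>y\<in>set ys. if x = y then f y else 0)"
      by (rule sum.reindex_bij_betw) (use that in \<open>auto intro: bij_betw_nth\<close>)
    then show ?thesis
      using that by simp
  qed
  have vs: "vs ! i \<in> set ws" "vs ! i \<in> set vs" and ws: "ws ! i \<in> set vs" "ws ! i \<in> set ws"
    if "i < n" for i
    using that n assms(3) by (metis nth_mem)+
  have eqs: "(vs ! i = vs ! j) = (i = j)" "(ws ! i = ws ! j) = (i = j)" if "i < n" "j < n" for i j
    using that n assms by (simp_all add: nth_eq_iff_index_eq)
  have "P * Q = 1\<^sub>m n"
  proof (rule eq_matI)
    fix i j assume ij: "i < dim_row (1\<^sub>m n :: real mat)" "j < dim_col (1\<^sub>m n :: real mat)"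
    have "(P * Q) $$ (i, j)
        = (\<Sum>k<n. if vs ! i = ws ! k then (if ws ! k = vs ! j then 1 else 0) else 0)"
      using ij by (auto simp: P_def Q_def scalar_prod_def atLeast0LessThan intro!: sum.cong)
    also have "\<dots> = (if vs ! i = vs ! j then 1 else 0)"
      using ij n assms vs by (subst select[where f = "\<lambda>x. if x = vs ! j then 1 else 0"]) auto
    finally show "(P * Q) $$ (i, j) = (1\<^sub>m n :: real mat) $$ (i, j)"
      using ij by (simp add: eqs)
  qed (auto simp: P_def Q_def)
  moreover have "Q * P = 1\<^sub>m n"
  proof (rule eq_matI)
    fix i j assume ij: "i < dim_row (1\<^sub>m n :: real mat)" "j < dim_col (1\<^sub>m n :: real mat)"
    have "(Q * P) $$ (i, j)
        = (\<Sum>k<n. if ws ! i = vs ! k then (if vs ! k = ws ! j then 1 else 0) else 0)"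
      using ij by (auto simp: P_def Q_def scalar_prod_def atLeast0LessThan intro!: sum.cong)
    also have "\<dots> = (if ws ! i = ws ! j then 1 else 0)"
      using ij n assms ws by (subst select[where f = "\<lambda>x. if x = ws ! j then 1 else 0"]) auto
    finally show "(Q * P) $$ (i, j) = (1\<^sub>m n :: real mat) $$ (i, j)"
      using ij by (simp add: eqs)
  qed (auto simp: P_def Q_def)
  moreover have "ecc_mat G vs = P * ecc_mat G ws * Q"
  proof (rule eq_matI)
    fix i j assume "i < dim_row (P * ecc_mat G ws * Q)" "j < dim_col (P * ecc_mat G ws * Q)"
    then have ij: "i < n" "j < n"
      by (auto simp: P_def Q_def)
    have left: "(P * ecc_mat G ws) $$ (i, l) = ecc_entry G (vs ! i) (ws ! l)" if "l < n" for l
    proof -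
      have "(P * ecc_mat G ws) $$ (i, l)
          = (\<Sum>k<n. if vs ! i = ws ! k then ecc_entry G (ws ! k) (ws ! l) else 0)"
        using ij that n
        by (auto simp: P_def ecc_mat_def scalar_prod_def atLeast0LessThan intro!: sum.cong)
      also have "\<dots> = ecc_entry G (vs ! i) (ws ! l)"
        using ij n assms vs by (subst select[where f = "\<lambda>x. ecc_entry G x (ws ! l)"]) auto
      finally show ?thesis .
    qed
    have "(P * ecc_mat G ws * Q) $$ (i, j) = (\<Sum>l<n. (P * ecc_mat G ws) $$ (i, l) * Q $$ (l, j))"
      using ij n
      by (subst index_mult_mat)
        (auto simp: P_def Q_def ecc_mat_def scalar_prod_def atLeast0LessThan intro!: sum.cong)
    also have "\<dots> = (\<Sum>l<n. if vs ! j = ws ! l then ecc_entry G (vs ! i) (ws ! l) else 0)"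
      using ij by (intro sum.cong refl) (auto simp: left Q_def)
    also have "\<dots> = ecc_entry G (vs ! i) (vs ! j)"
      using ij n assms vs by (subst select[where f = "ecc_entry G (vs ! i)"]) auto
    finally show "ecc_mat G vs $$ (i, j) = (P * ecc_mat G ws * Q) $$ (i, j)"
      using ij n by (simp add: ecc_mat_def)
  qed (auto simp: P_def Q_def ecc_mat_def n)
  ultimately have "similar_mat (ecc_mat G vs) (ecc_mat G ws)"
    by (intro similar_matI[where P = P and Q = Q and n = n])
      (auto simp: P_def Q_def ecc_mat_def n)
  then show ?thesis
    by (rule char_poly_similar)
qed

text \<open>
  \<open>ecc_eigval k G\<close> is the \<open>k\<close>-th largest eigenvalue, \<open>k\<close> counted from 1 and eigenvalues counted
  with algebraic multiplicity. As the matrix is real symmetric, all of its eigenvalues are real and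
  the list below has \<open>card (pverts G)\<close> entries.
\<close>

definition ecc_eigval :: "nat \<Rightarrow> 'a pair_pre_digraph \<Rightarrow> real" where
  "ecc_eigval k G =
     rev (sorted_list_of_multiset (proots (char_poly (eccentricity_matrix G)))) ! (k - 1)"

text \<open>
  The tree written \<open>T\<close> with subscripts \<open>n, 3\<close> and superscripts \<open>0, n - 4\<close>: the path 0, 1, 2, 3
  together with the pendant vertices \<open>4, \<dots>, n - 1\<close> attached to 2.
\<close>

definition broom_edges :: "nat \<Rightarrow> (nat \<times> nat) set" where
  "broom_edges n = {(0, 1), (1, 2), (2, 3)} \<union> {(2, i) |i. 4 \<le> i \<and> i < n}"

definition broom :: "nat \<Rightarrow> nat pair_pre_digraph" where
  "broom n = \<lparr>pverts = {..<n}, parcs = broom_edges n \<union> (broom_edges n)\<inverse>\<rparr>"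

end

theory Submission
  imports
    Defs
    "HOL-Computational_Algebra.Fundamental_Theorem_Algebra"
    "HOL-Combinatorics.Permutations"
begin

text \<open>
  The number 10/9 separates the broom from all other trees that are not stars. On the
  hyperplane of codimension one that kills the contribution of the pendant vertices, the quadratic
  form of the broom is below 10/9 times the squared norm, so its second eigenvalue is less than 10/9.
  For the lower bounds it suffices to exhibit a plane, supported on a few vertices, on which the
  quadratic form of the tree is at least 10/9 times the squared norm. In a tree of diameter \<open>D \<ge> 4\<close>,
  take a diametral path and the vectors (1, 0, 0, 1) and (1, -2, 2, -1) on its first two and last two
  vertices: their Rayleigh quotients are \<open>D\<close> and \<open>(3 D - 4) / 5\<close>. A tree of diameter 3 is a
  double star. If both centres have at least two leaves, two leaves on either side and the two centres
  carry such a plane, the smaller quotient being exactly 10/9; otherwise the tree is the broom.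
\<close>

section \<open>The second largest eigenvalue of a real symmetric matrix\<close>

text \<open>The strict gap settles the equality case, so the second eigenvalue of the broom never
  has to be computed. The room for the separating number is small: on the hyperplane the quotient of
  the broom is at most 4 / sqrt 13 = 1.1094... for every \<open>n\<close>, while in the double star
  with two leaves on either side the vectors that change sign when the sides are exchanged reach
  sqrt 17 - 3 = 1.1231.... The rational 10/9 lies in between. Eccentricities are global, so a
  principal submatrix of an eccentricity matrix need not be the eccentricity matrix of a subtree.
  Hence the test vectors live only on vertices whose eccentricities and mutual distances are forced
  by a longest path. Each plane is spanned by an even and an odd vector with respect to the reversal
  of that path; these are orthogonal both for the inner product and for the form, so a bound on the
  plane reduces to two Rayleigh quotients.\<close>

lemma scalar_prod_pos:
  fixes x :: "real vec"
  assumes "x \<in> carrier_vec n" "x \<noteq> 0\<^sub>v n"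
  shows "x \<bullet> x > 0"
proof -
  obtain i where "i < n" "x $ i \<noteq> 0"
    using assms by (metis carrier_vecD eq_vecI index_zero_vec)
  then show ?thesis
    using assms by (auto simp: scalar_prod_def zero_less_mult_iff intro!: sum_pos2[of _ i])
qed

text \<open>A complex eigenvalue \<open>l\<close> exists because the characteristic polynomial has
  positive degree. Symmetry makes the Hermitian form of an eigenvector equal to its conjugate, so
  \<open>l\<close> is real, hence a root of the real characteristic polynomial, which supplies a
  real eigenvector.\<close>

lemma real_symmetric_eigenvector:
  fixes A :: "real mat"
  assumes A: "A \<in> carrier_mat n n" and sym: "A\<^sup>T = A" and n: "n > 0"
  obtains v e where "v \<in> carrier_vec n" "v \<bullet> v = 1" "A *\<^sub>v v = e \<cdot>\<^sub>v v"
proof -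
  define C where "C = map_mat complex_of_real A"
  have C: "C \<in> carrier_mat n n" using A by (simp add: C_def)
  have symij: "A $$ (i, j) = A $$ (j, i)" if "i < n" "j < n" for i j
    using that A sym by (metis carrier_matD index_transpose_mat(1))
  have "degree (char_poly C) = n"
    using degree_monic_char_poly[OF C] by simp
  then obtain l where l: "poly (char_poly C) l = 0"
    using fundamental_theorem_of_algebra[of "char_poly C"] n constant_degree[of "char_poly C"] by auto
  then obtain z where z: "z \<in> carrier_vec n" "z \<noteq> 0\<^sub>v n" "C *\<^sub>v z = l \<cdot>\<^sub>v z"
    using eigenvalue_root_char_poly[OF C] C unfolding eigenvalue_def eigenvector_def by auto
  have row: "(\<Sum>j<n. of_real (A $$ (i, j)) * z $ j) = l * z $ i" if "i < n" for i
  proof -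
    have "(C *\<^sub>v z) $ i = (l \<cdot>\<^sub>v z) $ i" using z by simp
    then show ?thesis
      using that z C A by (simp add: C_def scalar_prod_def atLeast0LessThan)
  qed
  define N where "N = (\<Sum>i<n. (cmod (z $ i))\<^sup>2)"
  have "N > 0"
  proof -
    obtain i where "i < n" "z $ i \<noteq> 0"
      using z by (metis carrier_vecD eq_vecI index_zero_vec)
    then show ?thesis unfolding N_def by (intro sum_pos2[of _ i]) auto
  qed
  \<comment> \<open>By the eigenvector equation this Hermitian form is \<open>l\<close> times the
    squared norm, and conjugating it merely exchanges the summation indices.\<close>
  define S where "S = (\<Sum>i<n. \<Sum>j<n. cnj (z $ i) * of_real (A $$ (i, j)) * z $ j)"
  have "S = (\<Sum>i<n. cnj (z $ i) * (l * z $ i))"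
    unfolding S_def by (intro sum.cong refl) (simp add: row[symmetric] sum_distrib_left mult.assoc)
  also have "\<dots> = l * of_real N"
    unfolding N_def of_real_sum sum_distrib_left
    by (intro sum.cong refl) (simp add: complex_norm_square mult_ac del: of_real_power)
  finally have SN: "S = l * of_real N" .
  have "cnj S = (\<Sum>i<n. \<Sum>j<n. cnj (z $ j) * of_real (A $$ (j, i)) * z $ i)"
    unfolding S_def cnj_sum by (intro sum.cong refl) (simp add: symij mult_ac)
  also have "\<dots> = S"
    unfolding S_def by (rule sum.swap)
  finally have "cnj l = l"
    using SN \<open>N > 0\<close> by auto
  then obtain e where e: "l = complex_of_real e"
    by (metis Reals_cases Reals_cnj_iff)
  have "map_poly complex_of_real (char_poly A) = char_poly C"
    unfolding C_def by (rule of_real_hom.char_poly_hom[OF A, symmetric])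
  then have "complex_of_real (poly (char_poly A) e) = poly (char_poly C) l"
    unfolding e by (metis of_real_hom.poly_map_poly)
  then have "poly (char_poly A) e = 0"
    using l by simp
  then obtain w where w: "w \<in> carrier_vec n" "w \<noteq> 0\<^sub>v n" "A *\<^sub>v w = e \<cdot>\<^sub>v w"
    using eigenvalue_root_char_poly[OF A] A unfolding eigenvalue_def eigenvector_def by auto
  have pos: "w \<bullet> w > 0"
    using scalar_prod_pos w by blast
  define v where "v = (1 / sqrt (w \<bullet> w)) \<cdot>\<^sub>v w"
  show ?thesis
  proof
    show "v \<in> carrier_vec n" using w by (simp add: v_def)
    show "v \<bullet> v = 1" using w pos by (simp add: v_def)
    show "A *\<^sub>v v = e \<cdot>\<^sub>v v"
      unfolding v_def mult_mat_vec[OF A w(1)] w(3) by (simp add: smult_smult_assoc mult.commute)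
  qed
qed

text \<open>\<open>H\<close> is the reflection in the hyperplane orthogonal to the difference of
  \<open>v\<close> and the first unit vector: a symmetric involution, hence orthogonal, exchanging
  the two. It thereby extends \<open>v\<close> to an orthonormal basis. If the two vectors agree
  there is nothing to reflect, and the identity serves.\<close>

lemma householder:
  fixes v :: "real vec"
  assumes v: "v \<in> carrier_vec (Suc m)" and unit: "v \<bullet> v = 1"
  obtains H where "H \<in> carrier_mat (Suc m) (Suc m)" "H\<^sup>T = H" "H * H = 1\<^sub>m (Suc m)"
    "H *\<^sub>v unit_vec (Suc m) 0 = v"
proof (cases "v = unit_vec (Suc m) 0")
  case True
  show ?thesis by (rule that[of "1\<^sub>m (Suc m)"]) (auto simp: True)
next
  case False
  let ?n = "Suc m"
  define w where "w i = v $ i - (if i = 0 then 1 else 0)" for i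
  define s where "s = (\<Sum>i<?n. w i * w i)"
  have "(\<Sum>i<?n. v $ i * v $ i) = 1"
    using unit v by (simp add: scalar_prod_def atLeast0LessThan)
  moreover have "s = (\<Sum>i<?n. v $ i * v $ i) - (\<Sum>i<?n. if i = 0 then 2 * v $ 0 - 1 else 0)"
    unfolding s_def w_def sum_subtractf[symmetric]
    by (intro sum.cong refl) (auto simp: algebra_simps)
  \<comment> \<open>The difference of two unit vectors has squared length 2 - 2
    \<open>v $ 0\<close>; this makes the reflection send the first unit vector exactly to
    \<open>v\<close>.\<close>
  ultimately have s0: "s = - 2 * w 0"
    by (simp add: w_def)
  have "s \<noteq> 0"
  proof
    assume "s = 0"
    then have "w i = 0" if "i < ?n" for i
      using that unfolding s_def by (subst (asm) sum_nonneg_eq_0_iff) auto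
    then have "v = unit_vec ?n 0"
      using v by (intro eq_vecI) (auto simp: w_def unit_vec_def)
    with False show False ..
  qed
  define H where "H = mat ?n ?n (\<lambda>(i, j). (if i = j then 1 else 0) - 2 / s * w i * w j)"
  show ?thesis
  proof
    show "H \<in> carrier_mat ?n ?n" by (simp add: H_def)
    show "H\<^sup>T = H" by (rule eq_matI) (auto simp: H_def)
    show "H * H = 1\<^sub>m ?n"
    proof (rule eq_matI)
      fix i j assume "i < dim_row (1\<^sub>m ?n :: real mat)" "j < dim_col (1\<^sub>m ?n :: real mat)"
      then have ij: "i < ?n" "j < ?n" by auto
      have "(H * H) $$ (i, j) = (\<Sum>k<?n. ((if i = k then 1 else 0) - 2 / s * w i * w k) *
          ((if k = j then 1 else 0) - 2 / s * w k * w j))"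
        using ij by (simp add: H_def scalar_prod_def atLeast0LessThan)
      also have "\<dots> = (\<Sum>k<?n. (if k = i then (if i = j then 1 else 0) - 2 / s * w i * w j else 0)
          - (if k = j then 2 / s * w i * w j else 0) + 4 / s\<^sup>2 * w i * w j * (w k * w k))"
        by (intro sum.cong refl) (auto simp: algebra_simps power2_eq_square)
      also have "\<dots> = (if i = j then 1 else 0) - 4 / s * w i * w j + 4 / s\<^sup>2 * w i * w j * s"
      proof -
        have "(\<Sum>k<?n. 4 / s\<^sup>2 * w i * w j * (w k * w k)) = 4 / s\<^sup>2 * w i * w j * s"
          unfolding sum_distrib_left[symmetric] by (simp only: s_def)
        then show ?thesis
          using ij by (simp add: sum.distrib sum_subtractf del: sum.lessThan_Suc)
      qed
      also have "\<dots> = (1\<^sub>m ?n :: real mat) $$ (i, j)"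
        using ij \<open>s \<noteq> 0\<close> by (simp add: power2_eq_square)
      finally show "(H * H) $$ (i, j) = (1\<^sub>m ?n :: real mat) $$ (i, j)" .
    qed (auto simp: H_def)
    show "H *\<^sub>v unit_vec ?n 0 = v"
    proof (rule eq_vecI)
      fix i assume "i < dim_vec v"
      then have i: "i < ?n" using v by simp
      have "(H *\<^sub>v unit_vec ?n 0) $ i = (if i = 0 then 1 else 0) - 2 / s * w i * w 0"
        using i by (simp add: H_def)
      also have "\<dots> = (if i = 0 then 1 else 0) - 2 * w 0 / s * w i"
        by simp
      also have "2 * w 0 / s = - 1"
        using s0 \<open>s \<noteq> 0\<close> by (simp add: field_simps)
      also have "(if i = 0 then 1 else 0) - - 1 * w i = v $ i"
        by (simp add: w_def)
      finally show "(H *\<^sub>v unit_vec ?n 0) $ i = v $ i" .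
    qed (use v in \<open>auto simp: H_def\<close>)
  qed
qed

lemma mult_block_diag:
  fixes A :: "'a :: comm_ring_1 mat"
  assumes "A \<in> carrier_mat n n" "A' \<in> carrier_mat n n" "B \<in> carrier_mat m m" "B' \<in> carrier_mat m m"
  shows "four_block_mat A (0\<^sub>m n m) (0\<^sub>m m n) B * four_block_mat A' (0\<^sub>m n m) (0\<^sub>m m n) B'
    = four_block_mat (A * A') (0\<^sub>m n m) (0\<^sub>m m n) (B * B')"
  using assms
  by (simp add: mult_four_block_mat[OF assms(1) zero_carrier_mat zero_carrier_mat assms(3)
        assms(2) zero_carrier_mat zero_carrier_mat assms(4)])

text \<open>Deflation: conjugating by a reflection that carries the first unit vector to an
  eigenvector clears the first column below the diagonal, symmetry clears the first row as well, and
  a symmetric block of size \<open>m\<close> remains.\<close>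

lemma real_symmetric_diagonalization:
  fixes A :: "real mat"
  assumes "A \<in> carrier_mat n n" "A\<^sup>T = A"
  shows "\<exists>Q f. Q \<in> carrier_mat n n \<and> Q\<^sup>T * Q = 1\<^sub>m n \<and> A = Q * mat_diag n f * Q\<^sup>T"
  using assms
proof (induction n arbitrary: A)
  case 0
  then show ?case by (intro exI[of _ "1\<^sub>m 0"] exI[of _ "\<lambda>_. 0"]) auto
next
  case (Suc m)
  let ?n = "Suc m"
  note A = Suc.prems(1) and sym = Suc.prems(2)
  obtain v e where v: "v \<in> carrier_vec ?n" "v \<bullet> v = 1" "A *\<^sub>v v = e \<cdot>\<^sub>v v"
    using real_symmetric_eigenvector[OF A sym] by blast
  obtain H where H: "H \<in> carrier_mat ?n ?n" "H\<^sup>T = H" "H * H = 1\<^sub>m ?n"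
    and Hv: "H *\<^sub>v unit_vec ?n 0 = v"
    using householder[OF v(1,2)] by blast
  define B where "B = H * (A * H)"
  have B: "B \<in> carrier_mat ?n ?n" using A H by (simp add: B_def)
  have symB: "B\<^sup>T = B"
  proof -
    have "B\<^sup>T = (A * H)\<^sup>T * H\<^sup>T" unfolding B_def using A H by (intro transpose_mult) auto
    also have "(A * H)\<^sup>T = H\<^sup>T * A\<^sup>T" using A H by (intro transpose_mult) auto
    finally show ?thesis using A H sym by (simp add: B_def)
  qed
  have "H *\<^sub>v v = unit_vec ?n 0"
  proof -
    have "H *\<^sub>v (H *\<^sub>v unit_vec ?n 0) = (H * H) *\<^sub>v unit_vec ?n 0"
      using H by (intro assoc_mult_mat_vec[symmetric]) auto
    then show ?thesis using H Hv by simp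
  qed
  moreover have "B *\<^sub>v unit_vec ?n 0 = H *\<^sub>v (A *\<^sub>v (H *\<^sub>v unit_vec ?n 0))"
    unfolding B_def using A H
    by (smt (verit) assoc_mult_mat_vec mult_carrier_mat unit_vec_carrier mult_mat_vec_carrier)
  ultimately have Be: "B *\<^sub>v unit_vec ?n 0 = e \<cdot>\<^sub>v unit_vec ?n 0"
    using Hv v H by (simp add: mult_mat_vec)
  have col0: "B $$ (i, 0) = (if i = 0 then e else 0)" if "i < ?n" for i
  proof -
    have "B $$ (i, 0) = (e \<cdot>\<^sub>v unit_vec ?n 0) $ i"
      unfolding Be[symmetric] using B that by simp
    then show ?thesis using that by simp
  qed
  have symBij: "B $$ (i, j) = B $$ (j, i)" if "i < ?n" "j < ?n" for i j
    using that B symB by (metis carrier_matD index_transpose_mat(1))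
  define B' where "B' = mat m m (\<lambda>(i, j). B $$ (Suc i, Suc j))"
  have B': "B' \<in> carrier_mat m m" by (simp add: B'_def)
  have "B'\<^sup>T = B'" by (rule eq_matI) (auto simp: B'_def symBij)
  then obtain Q' f where Q': "Q' \<in> carrier_mat m m" "Q'\<^sup>T * Q' = 1\<^sub>m m" "B' = Q' * mat_diag m f * Q'\<^sup>T"
    using Suc.IH[OF B'] by blast
  define E where "E = mat 1 1 (\<lambda>_. e)"
  define F where "F = four_block_mat (1\<^sub>m 1) (0\<^sub>m 1 m) (0\<^sub>m m 1) Q'"
  define D where "D = four_block_mat E (0\<^sub>m 1 m) (0\<^sub>m m 1) (mat_diag m f)"
  have E: "E \<in> carrier_mat 1 1" by (simp add: E_def)
  have F: "F \<in> carrier_mat ?n ?n" unfolding F_def using Q'(1) by (auto intro: four_block_carrier_mat[of _ 1 1 _ m m, simplified])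
  have D: "D \<in> carrier_mat ?n ?n" unfolding D_def using E by (auto intro: four_block_carrier_mat[of _ 1 1 _ m m, simplified])
  have FT: "F\<^sup>T = four_block_mat (1\<^sub>m 1) (0\<^sub>m 1 m) (0\<^sub>m m 1) Q'\<^sup>T"
    unfolding F_def using Q'(1) by (subst transpose_four_block_mat) auto
  have FTF: "F\<^sup>T * F = 1\<^sub>m ?n"
    unfolding FT unfolding F_def using Q'
    by (simp add: mult_block_diag[of _ 1 _ _ m] four_block_one_mat[of 1 m] del: One_nat_def) simp
  have "B = four_block_mat E (0\<^sub>m 1 m) (0\<^sub>m m 1) B'"
  proof (rule eq_matI)
    fix i j assume "i < dim_row (four_block_mat E (0\<^sub>m 1 m) (0\<^sub>m m 1) B')"
      "j < dim_col (four_block_mat E (0\<^sub>m 1 m) (0\<^sub>m m 1) B')"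
    then have ij: "i < ?n" "j < ?n" using E B' by auto
    have "B $$ (i, j) = (if i = 0 then if j = 0 then e else 0 else if j = 0 then 0 else B' $$ (i - 1, j - 1))"
      using col0[OF ij(1)] col0[OF ij(2)] symBij[OF ij] ij by (auto simp: B'_def)
    then show "B $$ (i, j) = four_block_mat E (0\<^sub>m 1 m) (0\<^sub>m m 1) B' $$ (i, j)"
      using E B' ij by (auto simp: E_def)
  qed (use B E B' in auto)
  also have "\<dots> = F * D * F\<^sup>T"
    unfolding FT unfolding F_def D_def using Q' E
    by (simp add: mult_block_diag[of _ 1 _ _ m] del: One_nat_def)
  finally have BF: "B = F * D * F\<^sup>T" .
  have HBH: "A = H * (B * H)"
  proof -
    have "H * (B * H) = H * ((H * (A * H)) * H)" by (simp add: B_def)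
    also have "(H * (A * H)) * H = H * ((A * H) * H)" using A H by (intro assoc_mult_mat) auto
    also have "(A * H) * H = A * (H * H)" using A H by (intro assoc_mult_mat) auto
    also have "H * (H * (A * (H * H))) = (H * H) * (A * (H * H))"
      using A H by (intro assoc_mult_mat[symmetric]) auto
    finally show ?thesis using A H by simp
  qed
  define Q where "Q = H * F"
  have Q: "Q \<in> carrier_mat ?n ?n" using H F by (simp add: Q_def)
  have QT: "Q\<^sup>T = F\<^sup>T * H" unfolding Q_def using H F by (subst transpose_mult) auto
  have "Q\<^sup>T * Q = F\<^sup>T * (H * (H * F))"
    unfolding QT unfolding Q_def using H F by (intro assoc_mult_mat) auto
  also have "H * (H * F) = (H * H) * F" using H F by (intro assoc_mult_mat[symmetric]) auto
  finally have QTQ: "Q\<^sup>T * Q = 1\<^sub>m ?n" using H F FTF by simp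
  have AQ: "A = Q * D * Q\<^sup>T"
  proof -
    have "Q * D * Q\<^sup>T = (H * (F * D)) * (F\<^sup>T * H)"
      unfolding QT unfolding Q_def using H F D by (simp add: assoc_mult_mat[of H ?n ?n F ?n D])
    also have "\<dots> = H * ((F * D) * (F\<^sup>T * H))" using H F D by (intro assoc_mult_mat) auto
    also have "(F * D) * (F\<^sup>T * H) = (F * D * F\<^sup>T) * H"
      using H F D by (intro assoc_mult_mat[symmetric]) auto
    finally show ?thesis using HBH BF by simp
  qed
  \<comment> \<open>\<open>case_nat e f\<close> puts the new eigenvalue at index 0 and shifts the
    earlier ones by one.\<close>
  have D_diag: "D = mat_diag ?n (case_nat e f)"
    unfolding D_def by (rule eq_matI) (auto simp: E_def mat_diag_def split: nat.splits)
  show ?case using Q QTQ AQ[unfolded D_diag] by blast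
qed

section \<open>Ordered eigenvalues and the variational bounds for the second one\<close>

lemma proots_char_poly_mat_diag:
  "proots (char_poly (mat_diag n f :: real mat)) = mset (map f [0..<n])"
proof -
  have linear: "proots (\<Prod>a\<leftarrow>xs. [:- a, 1:]) = mset xs" for xs :: "real list"
  proof (induction xs)
    case (Cons a xs)
    have "(\<Prod>a\<leftarrow>xs. [:- a, 1:]) \<noteq> 0" by (auto simp: prod_list_zero_iff)
    with Cons show ?case by (simp add: proots_mult del: mult_pCons_left)
  qed simp
  have "diag_mat (mat_diag n f) = map f [0..<n]"
    by (auto simp: diag_mat_def mat_diag_def intro: map_cong)
  moreover have "upper_triangular (mat_diag n f)"
    by (auto simp: mat_diag_def)
  ultimately show ?thesis
    by (simp add: char_poly_upper_triangular[of _ n] linear del: map_map mset_map)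
qed

text \<open>Positions are produced rather than values, so that a repeated largest eigenvalue still
  comes with two different indices, that is, with two orthogonal eigenvectors.\<close>

lemma second_largest:
  fixes f :: "nat \<Rightarrow> 'a :: linorder"
  assumes "2 \<le> n"
  obtains i j where "i < n" "j < n" "i \<noteq> j"
    "f j = rev (sorted_list_of_multiset (mset (map f [0..<n]))) ! 1"
    "f j \<le> f i" "\<And>k. k < n \<Longrightarrow> k \<noteq> i \<Longrightarrow> f k \<le> f j"
proof -
  define xs where "xs = map f [0..<n]"
  define ys where "ys = rev (sorted_list_of_multiset (mset xs))"
  have ys: "mset ys = mset xs" "sorted (rev ys)" by (simp_all add: ys_def)
  then have len: "length ys = n" by (metis length_map length_upt minus_nat.diff_0 size_mset xs_def)
  obtain p where p: "p permutes {..<length xs}" "permute_list p xs = ys"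
    using mset_eq_permutation[OF ys(1)] .
  have lx: "length xs = n" by (simp add: xs_def)
  have pn: "p k < n" if "k < n" for k
    using p(1) that lx by (metis lessThan_iff permutes_in_image)
  have nth: "ys ! k = f (p k)" if "k < n" for k
    using p that lx pn[OF that] permute_list_nth[OF p(1), of k] by (simp add: xs_def)
  have mono: "ys ! l \<le> ys ! k" if "k \<le> l" "l < n" for k l
    using ys(2) that len sorted_rev_nth_mono by blast
  show ?thesis
  proof (rule that[of "p 0" "p 1"])
    show "p 0 < n" "p 1 < n" using assms pn by auto
    show "p 0 \<noteq> p 1" using permutes_inj[OF p(1)] by (auto dest: injD)
    show "f (p 1) = rev (sorted_list_of_multiset (mset (map f [0..<n]))) ! 1"
      using nth[of 1] assms by (simp add: ys_def xs_def)
    show "f (p 1) \<le> f (p 0)"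
      using mono[of 0 1] nth[of 0] nth[of 1] assms by simp
    fix k assume k: "k < n" "k \<noteq> p 0"
    obtain l where l: "k = p l" using permutes_surj[OF p(1)] by (metis surjD)
    then have "l < n" using k(1) p(1) lx by (metis lessThan_iff permutes_in_image)
    moreover have "1 \<le> l" using k l by (cases l) auto
    ultimately show "f k \<le> f (p 1)"
      using mono[of 1 l] nth[of l] nth[of 1] l by simp
  qed
qed

definition second_eigenvalue :: "real mat \<Rightarrow> real" where
  "second_eigenvalue A = rev (sorted_list_of_multiset (proots (char_poly A))) ! 1"

lemma second_eigenvalue_spectral:
  fixes A :: "real mat"
  assumes A: "A \<in> carrier_mat n n" and sym: "A\<^sup>T = A" and n: "2 \<le> n"
  obtains Q f i j where "Q \<in> carrier_mat n n" "Q\<^sup>T * Q = 1\<^sub>m n" "Q * Q\<^sup>T = 1\<^sub>m n"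
    "A = Q * mat_diag n f * Q\<^sup>T" "i < n" "j < n" "i \<noteq> j" "f j = second_eigenvalue A"
    "f j \<le> f i" "\<And>k. k < n \<Longrightarrow> k \<noteq> i \<Longrightarrow> f k \<le> f j"
proof -
  obtain Q f where Q: "Q \<in> carrier_mat n n" "Q\<^sup>T * Q = 1\<^sub>m n" "A = Q * mat_diag n f * Q\<^sup>T"
    using real_symmetric_diagonalization[OF A sym] by blast
  have Q': "Q * Q\<^sup>T = 1\<^sub>m n"
    using mat_mult_left_right_inverse[of "Q\<^sup>T" n Q] Q by simp
  have "similar_mat A (mat_diag n f)"
    by (rule similar_matI[where P = Q and Q = "Q\<^sup>T" and n = n]) (use A Q Q' in auto)
  then have "second_eigenvalue A = rev (sorted_list_of_multiset (mset (map f [0..<n]))) ! 1"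
    by (simp only: second_eigenvalue_def char_poly_similar proots_char_poly_mat_diag)
  moreover obtain i j where "i < n" "j < n" "i \<noteq> j"
      "f j = rev (sorted_list_of_multiset (mset (map f [0..<n]))) ! 1"
      "f j \<le> f i" "\<And>k. k < n \<Longrightarrow> k \<noteq> i \<Longrightarrow> f k \<le> f j"
    by (rule second_largest[OF n, of f]) blast
  ultimately show ?thesis using that[OF Q(1,2) Q' Q(3)] by metis
qed

lemma quadratic_form_diagonalized:
  fixes Q :: "real mat"
  assumes Q: "Q \<in> carrier_mat n n" and x: "x \<in> carrier_vec n"
  shows "x \<bullet> ((Q * mat_diag n f * Q\<^sup>T) *\<^sub>v x) = (\<Sum>k<n. f k * ((Q\<^sup>T *\<^sub>v x) $ k)\<^sup>2)"
proof -
  define y where "y = Q\<^sup>T *\<^sub>v x"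
  have y: "y \<in> carrier_vec n" using Q x by (simp add: y_def)
  have D: "mat_diag n f \<in> carrier_mat n n" by simp
  have Dy: "mat_diag n f *\<^sub>v y \<in> carrier_vec n" by (rule mult_mat_vec_carrier[OF D y])
  have "(Q * mat_diag n f * Q\<^sup>T) *\<^sub>v x = (Q * mat_diag n f) *\<^sub>v y"
    unfolding y_def using Q x by (intro assoc_mult_mat_vec[of _ n n _ n]) auto
  also have "\<dots> = Q *\<^sub>v (mat_diag n f *\<^sub>v y)"
    using Q D y by (intro assoc_mult_mat_vec[of _ n n _ n]) auto
  finally have "x \<bullet> ((Q * mat_diag n f * Q\<^sup>T) *\<^sub>v x) = y \<bullet> (mat_diag n f *\<^sub>v y)"
    using transpose_vec_mult_scalar[OF Q Dy x] by (simp add: y_def)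
  also have "\<dots> = (\<Sum>k<n. y $ k * (mat_diag n f *\<^sub>v y) $ k)"
    using carrier_matD(1)[OF D] by (simp add: scalar_prod_def atLeast0LessThan del: index_mult_mat_vec)
  also have "\<dots> = (\<Sum>k<n. f k * (y $ k)\<^sup>2)"
  proof (intro sum.cong refl)
    fix k assume "k \<in> {..<n}"
    then have k: "k < n" by simp
    have "(mat_diag n f *\<^sub>v y) $ k = f k * y $ k"
      using k y by (simp add: mat_diag_def scalar_prod_def atLeast0LessThan
          if_distrib[of "\<lambda>a. a * _"] cong: if_cong)
    then show "y $ k * (mat_diag n f *\<^sub>v y) $ k = f k * (y $ k)\<^sup>2"
      using k by (simp add: power2_eq_square)
  qed
  finally show ?thesis by (simp add: y_def)
qed

lemma norm_orthogonal_transform: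
  fixes Q :: "real mat"
  assumes Q: "Q \<in> carrier_mat n n" "Q * Q\<^sup>T = 1\<^sub>m n" and x: "x \<in> carrier_vec n"
  shows "x \<bullet> x = (\<Sum>k<n. ((Q\<^sup>T *\<^sub>v x) $ k)\<^sup>2)"
proof -
  have "Q * mat_diag n (\<lambda>_. 1) * Q\<^sup>T = 1\<^sub>m n"
    using Q by simp
  with quadratic_form_diagonalized[OF Q(1) x, of "\<lambda>_. 1"] show ?thesis
    using x by simp
qed

lemma nontrivial_combination:
  fixes a b :: real
  obtains r s where "r * a + s * b = 0" "r \<noteq> 0 \<or> s \<noteq> 0"
  by (cases "b = 0") (auto intro: that[of 0 1] that[of b "- a"])

text \<open>The max-min half of Courant-Fischer: a plane contains a nonzero vector orthogonal to the
  eigenvector of the largest eigenvalue, and there the form is at most the second eigenvalue times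
  the squared norm.\<close>

lemma second_eigenvalue_ge:
  fixes A :: "real mat"
  assumes A: "A \<in> carrier_mat n n" "A\<^sup>T = A" "2 \<le> n"
    and x: "x \<in> carrier_vec n" and y: "y \<in> carrier_vec n"
    and indep: "\<And>r s. r \<cdot>\<^sub>v x + s \<cdot>\<^sub>v y = 0\<^sub>v n \<Longrightarrow> r = 0 \<and> s = 0"
    and form: "\<And>r s z. z = r \<cdot>\<^sub>v x + s \<cdot>\<^sub>v y \<Longrightarrow> c * (z \<bullet> z) \<le> z \<bullet> (A *\<^sub>v z)"
  shows "c \<le> second_eigenvalue A"
proof -
  obtain Q f i j where Q: "Q \<in> carrier_mat n n" "Q\<^sup>T * Q = 1\<^sub>m n" "Q * Q\<^sup>T = 1\<^sub>m n"
    "A = Q * mat_diag n f * Q\<^sup>T" and ij: "i < n" "j < n" "i \<noteq> j" "f j = second_eigenvalue A"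
    and f: "f j \<le> f i" "\<And>k. k < n \<Longrightarrow> k \<noteq> i \<Longrightarrow> f k \<le> f j"
    using second_eigenvalue_spectral[OF A] by metis
  obtain r s where rs: "r * (Q\<^sup>T *\<^sub>v x) $ i + s * (Q\<^sup>T *\<^sub>v y) $ i = 0" "r \<noteq> 0 \<or> s \<noteq> 0"
    using nontrivial_combination .
  define z where "z = r \<cdot>\<^sub>v x + s \<cdot>\<^sub>v y"
  have z: "z \<in> carrier_vec n" using x y by (simp add: z_def)
  have "z \<noteq> 0\<^sub>v n" using indep rs(2) by (auto simp: z_def)
  then have pos: "z \<bullet> z > 0" using scalar_prod_pos[OF z] by simp
  have QT: "Q\<^sup>T \<in> carrier_mat n n" using Q by simp
  have "Q\<^sup>T *\<^sub>v z = r \<cdot>\<^sub>v (Q\<^sup>T *\<^sub>v x) + s \<cdot>\<^sub>v (Q\<^sup>T *\<^sub>v y)"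
    unfolding z_def using QT x y by (simp add: mult_add_distrib_mat_vec[OF QT] mult_mat_vec[OF QT])
  then have zi: "(Q\<^sup>T *\<^sub>v z) $ i = 0"
    using rs(1) ij(1) x y QT by (simp del: index_mult_mat_vec)
  have "c * (z \<bullet> z) \<le> z \<bullet> (A *\<^sub>v z)"
    by (rule form[OF z_def])
  also have "\<dots> = (\<Sum>k<n. f k * ((Q\<^sup>T *\<^sub>v z) $ k)\<^sup>2)"
    unfolding Q(4) by (rule quadratic_form_diagonalized[OF Q(1) z])
  also have "\<dots> \<le> (\<Sum>k<n. f j * ((Q\<^sup>T *\<^sub>v z) $ k)\<^sup>2)"
  proof (rule sum_mono)
    fix k assume "k \<in> {..<n}"
    then show "f k * ((Q\<^sup>T *\<^sub>v z) $ k)\<^sup>2 \<le> f j * ((Q\<^sup>T *\<^sub>v z) $ k)\<^sup>2"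
      using f(2)[of k] zi by (cases "k = i") (auto intro: mult_right_mono simp del: index_mult_mat_vec)
  qed
  also have "\<dots> = f j * (z \<bullet> z)"
    by (simp add: norm_orthogonal_transform[OF Q(1,3) z] sum_distrib_left)
  finally show ?thesis using pos ij(4) by simp
qed

text \<open>The min-max half: the span of the eigenvectors of the two largest eigenvalues meets the
  hyperplane orthogonal to \<open>w\<close> in a nonzero vector, where the form is at least the
  second eigenvalue times the squared norm. Strictness survives because a single vector is
  compared.\<close>

lemma second_eigenvalue_less:
  fixes A :: "real mat"
  assumes A: "A \<in> carrier_mat n n" "A\<^sup>T = A" "2 \<le> n"
    and w: "w \<in> carrier_vec n"
    and form: "\<And>z. z \<in> carrier_vec n \<Longrightarrow> z \<noteq> 0\<^sub>v n \<Longrightarrow> w \<bullet> z = 0 \<Longrightarrow> z \<bullet> (A *\<^sub>v z) < c * (z \<bullet> z)"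
  shows "second_eigenvalue A < c"
proof -
  obtain Q f i j where Q: "Q \<in> carrier_mat n n" "Q\<^sup>T * Q = 1\<^sub>m n" "Q * Q\<^sup>T = 1\<^sub>m n"
    "A = Q * mat_diag n f * Q\<^sup>T" and ij: "i < n" "j < n" "i \<noteq> j" "f j = second_eigenvalue A"
    and f: "f j \<le> f i" "\<And>k. k < n \<Longrightarrow> k \<noteq> i \<Longrightarrow> f k \<le> f j"
    using second_eigenvalue_spectral[OF A] by metis
  obtain r s where rs: "r * (Q\<^sup>T *\<^sub>v w) $ i + s * (Q\<^sup>T *\<^sub>v w) $ j = 0" "r \<noteq> 0 \<or> s \<noteq> 0"
    using nontrivial_combination .
  define u where "u = r \<cdot>\<^sub>v unit_vec n i + s \<cdot>\<^sub>v unit_vec n j"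
  have u: "u \<in> carrier_vec n" by (simp add: u_def)
  define z where "z = Q *\<^sub>v u"
  have z: "z \<in> carrier_vec n" using Q u by (simp add: z_def)
  have QTz: "Q\<^sup>T *\<^sub>v z = u"
    unfolding z_def using Q u by (subst assoc_mult_mat_vec[symmetric, of _ n n _ n]) auto
  have uk: "u $ k = (if k = i then r else if k = j then s else 0)" if "k < n" for k
    using that ij by (auto simp: u_def)
  have "u $ i \<noteq> 0 \<or> u $ j \<noteq> 0" using rs(2) ij uk by simp
  then have "u \<noteq> 0\<^sub>v n" using ij by auto
  moreover have "Q\<^sup>T *\<^sub>v 0\<^sub>v n = 0\<^sub>v n" using Q by auto
  ultimately have "z \<noteq> 0\<^sub>v n" using QTz by auto
  have "w \<bullet> z = (Q\<^sup>T *\<^sub>v w) \<bullet> u"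
    unfolding z_def using transpose_vec_mult_scalar[OF Q(1) u w] by simp
  also have "\<dots> = r * (Q\<^sup>T *\<^sub>v w) $ i + s * (Q\<^sup>T *\<^sub>v w) $ j"
    unfolding u_def using ij Q w
    by (simp add: scalar_prod_add_distrib[of _ n] del: index_mult_mat_vec)
  finally have "w \<bullet> z = 0" using rs by simp
  have sums: "z \<bullet> z = (\<Sum>k<n. (u $ k)\<^sup>2)" "z \<bullet> (A *\<^sub>v z) = (\<Sum>k<n. f k * (u $ k)\<^sup>2)"
    using norm_orthogonal_transform[OF Q(1,3) z] quadratic_form_diagonalized[OF Q(1) z, of f]
    by (simp_all add: QTz Q(4))
  have pos: "z \<bullet> z > 0" using scalar_prod_pos[OF z \<open>z \<noteq> 0\<^sub>v n\<close>] .
  have "f j * (z \<bullet> z) = (\<Sum>k<n. f j * (u $ k)\<^sup>2)"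
    by (simp add: sums(1) sum_distrib_left)
  also have "\<dots> \<le> z \<bullet> (A *\<^sub>v z)"
    unfolding sums(2) using f(1) uk by (intro sum_mono) (auto intro: mult_right_mono)
  also have "\<dots> < c * (z \<bullet> z)"
    by (rule form) fact+
  finally show ?thesis using pos ij(4) by simp
qed

section \<open>Distances in graphs and trees\<close>

text \<open>Meant for the lengths of paths as \<open>P\<close> and of walks as \<open>Q\<close>:
  different sets with the same minimum. If both are empty, \<open>LEAST\<close> is the same
  unspecified number for both.\<close>

lemma Least_nat_eqI:
  fixes P Q :: "nat \<Rightarrow> bool"
  assumes PQ: "\<And>k. P k \<Longrightarrow> Q k" and QP: "\<And>k. Q k \<Longrightarrow> \<exists>j\<le>k. P j"
  shows "(LEAST k. P k) = (LEAST k. Q k)"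
proof (cases "\<exists>k. Q k")
  case True
  then obtain j where "j \<le> (LEAST k. Q k)" "P j"
    using QP LeastI_ex by metis
  then have "P (LEAST k. Q k)"
    using PQ Least_le[of Q j] by (metis le_antisym)
  then show ?thesis
    using PQ by (intro Least_equality) (auto intro: Least_le)
next
  case False
  then have "P = Q" using PQ by auto
  then show ?thesis by simp
qed

context pair_wf_digraph
begin

text \<open>Powers of the arc relation replace arc lists, which makes concatenation and induction on
  the length easy. \<open>u\<close> has to be a vertex because the power 0 relates every element to
  itself.\<close>

lemma awalk_iff_relpow:
  assumes "u \<in> pverts G"
  shows "(\<exists>p. awalk u p v \<and> length p = k) \<longleftrightarrow> (u, v) \<in> parcs G ^^ k"
  using assms
proof (induction k arbitrary: u)
  case 0
  then show ?case by (auto simp: awalk_Nil_iff)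
next
  case (Suc k)
  have "(\<exists>p. awalk u p v \<and> length p = Suc k)
      \<longleftrightarrow> (\<exists>w. (u, w) \<in> parcs G \<and> (\<exists>p. awalk w p v \<and> length p = k))"
  proof safe
    fix p assume "awalk u p v" "length p = Suc k"
    then obtain w q where "(u, w) \<in> parcs G" "awalk w q v" "length q = k"
      by (cases p) (auto simp: awalk_Cons_iff)
    then show "\<exists>w. (u, w) \<in> parcs G \<and> (\<exists>p. awalk w p v \<and> length p = k)"
      by blast
  next
    fix w p assume "(u, w) \<in> parcs G" "awalk w p v" "k = length p"
    then show "\<exists>q. awalk u q v \<and> length q = Suc (length p)"
      by (intro exI[of _ "(u, w) # p"]) (auto simp: awalk_Cons_iff)
  qed
  also have "\<dots> \<longleftrightarrow> (\<exists>w. (u, w) \<in> parcs G \<and> (w, v) \<in> parcs G ^^ k)"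
    using Suc.IH in_arcsD2 by blast
  also have "\<dots> \<longleftrightarrow> (u, v) \<in> parcs G ^^ Suc k"
    by (meson relpow_Suc_D2 relpow_Suc_I2)
  finally show ?case .
qed

text \<open>Shortening a walk to a path keeps only arcs of the walk, each at most once, so the
  minimum over walks is attained by a path.\<close>

lemma gdist_relpow:
  assumes "u \<in> pverts G"
  shows "gdist G u v = (LEAST k. (u, v) \<in> parcs G ^^ k)"
  unfolding gdist_def
proof (rule Least_nat_eqI)
  fix k assume "\<exists>p. apath u p v \<and> length p = k"
  then show "(u, v) \<in> parcs G ^^ k"
    using awalk_iff_relpow[OF assms] awalkI_apath by blast
next
  fix k assume "(u, v) \<in> parcs G ^^ k"
  then obtain p where p: "awalk u p v" "length p = k"
    using awalk_iff_relpow[OF assms] by blast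
  let ?q = "awalk_to_apath p"
  have q: "apath u ?q v" using apath_awalk_to_apath[OF p(1)] .
  then have "distinct ?q" by (auto simp: apath_def intro: distinct_verts_imp_distinct)
  then have "length ?q = card (set ?q)" by (simp add: distinct_card)
  also have "\<dots> \<le> card (set p)"
    using awalk_to_apath_subset[OF p(1)] by (intro card_mono) auto
  also have "\<dots> \<le> k" using card_length[of p] p(2) by simp
  finally show "\<exists>j\<le>k. \<exists>q. apath u q v \<and> length q = j" using q by blast
qed

text \<open>A certificate for distances from \<open>r\<close>: the step bound makes \<open>f\<close>
  a lower bound along every walk, and descending from \<open>v\<close> through vertices where
  \<open>f\<close> drops by one yields a walk of length \<open>f v\<close>.\<close>

lemma gdist_eqI:
  fixes f :: "'a \<Rightarrow> nat"
  assumes r: "r \<in> pverts G" "f r = 0" and v: "v \<in> pverts G"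
    and lip: "\<And>x y. (x, y) \<in> parcs G \<Longrightarrow> f y \<le> Suc (f x)"
    and dec: "\<And>y. y \<in> pverts G \<Longrightarrow> y \<noteq> r \<Longrightarrow> \<exists>x. (x, y) \<in> parcs G \<and> f y = Suc (f x)"
  shows "gdist G r v = f v"
proof -
  have lower: "f y \<le> k" if "(r, y) \<in> parcs G ^^ k" for y k
    using that
  proof (induction k arbitrary: y)
    case (Suc k)
    then obtain x where "(r, x) \<in> parcs G ^^ k" "(x, y) \<in> parcs G" by auto
    then show ?case using Suc.IH lip by fastforce
  qed (simp add: r)
  have "(r, y) \<in> parcs G ^^ f y" if "y \<in> pverts G" for y
    using that
  proof (induction "f y" arbitrary: y)
    case 0
    then show ?case using dec[of y] by (cases "y = r") auto
  next
    case (Suc k)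
    then have "y \<noteq> r" using r by auto
    then obtain x where x: "(x, y) \<in> parcs G" "f y = Suc (f x)" using dec Suc.prems by blast
    then have "(r, x) \<in> parcs G ^^ f x" using Suc in_arcsD1 by auto
    then show ?case using x by auto
  qed
  then have "(r, v) \<in> parcs G ^^ f v" using v by blast
  then show ?thesis
    unfolding gdist_relpow[OF r(1)] using lower by (intro Least_equality) auto
qed

end

lemma gdist_iso:
  assumes G: "pair_wf_digraph G" and H: "pair_wf_digraph H"
    and inj: "inj_on h (pverts G)" and verts: "pverts H = h ` pverts G"
    and arcs: "parcs H = map_prod h h ` parcs G"
    and u: "u \<in> pverts G" and v: "v \<in> pverts G"
  shows "gdist H (h u) (h v) = gdist G u v"
proof -
  interpret G: pair_wf_digraph G by fact
  interpret H: pair_wf_digraph H by fact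
  have "(h u, h v) \<in> parcs H ^^ k \<longleftrightarrow> (u, v) \<in> parcs G ^^ k" for k
    using v
  proof (induction k arbitrary: v)
    case 0
    then show ?case using inj u by (auto dest: inj_onD)
  next
    case (Suc k)
    have "(h u, h v) \<in> parcs H ^^ Suc k \<longleftrightarrow> (\<exists>y. (h u, y) \<in> parcs H ^^ k \<and> (y, h v) \<in> parcs H)"
      by auto
    also have "\<dots> \<longleftrightarrow> (\<exists>w\<in>pverts G. (h u, h w) \<in> parcs H ^^ k \<and> (h w, h v) \<in> parcs H)"
    proof
      assume "\<exists>y. (h u, y) \<in> parcs H ^^ k \<and> (y, h v) \<in> parcs H"
      then obtain y where y: "(h u, y) \<in> parcs H ^^ k" "(y, h v) \<in> parcs H" by blast
      then obtain w where "w \<in> pverts G" "y = h w" using H.in_arcsD1[of y] verts by auto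
      with y show "\<exists>w\<in>pverts G. (h u, h w) \<in> parcs H ^^ k \<and> (h w, h v) \<in> parcs H" by blast
    qed blast
    also have "\<dots> \<longleftrightarrow> (\<exists>w\<in>pverts G. (u, w) \<in> parcs G ^^ k \<and> (w, v) \<in> parcs G)"
    proof -
      have "(h w, h v) \<in> parcs H \<longleftrightarrow> (w, v) \<in> parcs G" if "w \<in> pverts G" for w
      proof
        assume "(h w, h v) \<in> parcs H"
        then obtain a b where ab: "(a, b) \<in> parcs G" "h w = h a" "h v = h b"
          unfolding arcs by auto
        then show "(w, v) \<in> parcs G"
          using inj that Suc.prems G.in_arcsD1[OF ab(1)] G.in_arcsD2[OF ab(1)] by (metis inj_onD)
      qed (force simp: arcs)
      then show ?thesis using Suc.IH by blast
    qed
    also have "\<dots> \<longleftrightarrow> (u, v) \<in> parcs G ^^ Suc k"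
      using G.in_arcsD1 by auto
    finally show ?case .
  qed
  then show ?thesis
    using u verts by (simp add: G.gdist_relpow H.gdist_relpow)
qed

section \<open>The path metric of a connected simple graph\<close>

locale connected_graph = pair_graph +
  assumes connected: "Digraph_Component.connected (with_proj G)"
begin

abbreviation "d \<equiv> gdist G"
abbreviation "V \<equiv> pverts G"

lemma relpow_sym: "(u, v) \<in> parcs G ^^ k \<Longrightarrow> (v, u) \<in> parcs G ^^ k"
proof (induction k arbitrary: v)
  case (Suc k)
  then show ?case by (meson arcs_symmetric relpow_Suc_E relpow_Suc_I2)
qed simp

lemma verts_nonempty: "V \<noteq> {}"
  using connected by (auto simp: connected_def strongly_connected_def)

lemma ex_relpow:
  assumes "u \<in> V" "v \<in> V"
  shows "\<exists>k. (u, v) \<in> parcs G ^^ k"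
proof -
  have "u \<rightarrow>\<^sup>*\<^bsub>mk_symmetric (with_proj G)\<^esub> v"
    using connected assms by (auto simp: connected_def strongly_connected_def)
  then have "u \<rightarrow>\<^sup>*\<^bsub>with_proj G\<^esub> v"
    using reachable_mk_symmetric_eq[OF sym_arcs] by simp
  then show ?thesis
    using awalk_iff_relpow[OF assms(1)] by (auto simp: reachable_awalk)
qed

lemma relpow_gdist: "u \<in> V \<Longrightarrow> v \<in> V \<Longrightarrow> (u, v) \<in> parcs G ^^ d u v"
  using ex_relpow by (simp add: gdist_relpow) (metis LeastI_ex)

lemma gdist_le: "u \<in> V \<Longrightarrow> (u, v) \<in> parcs G ^^ k \<Longrightarrow> d u v \<le> k"
  by (simp add: gdist_relpow Least_le)

lemma gdist_sym: "u \<in> V \<Longrightarrow> v \<in> V \<Longrightarrow> d u v = d v u"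
  by (meson gdist_le le_antisym relpow_gdist relpow_sym)

lemma gdist_self [simp]: "u \<in> V \<Longrightarrow> d u u = 0"
  using gdist_le[of u u 0] by simp

lemma gdist_eq_0_iff: "u \<in> V \<Longrightarrow> v \<in> V \<Longrightarrow> d u v = 0 \<longleftrightarrow> u = v"
  using relpow_gdist[of u v] by auto

lemma gdist_triangle: "u \<in> V \<Longrightarrow> v \<in> V \<Longrightarrow> w \<in> V \<Longrightarrow> d u w \<le> d u v + d v w"
  by (meson gdist_le relpow_gdist relpow_trans)

lemma gdist_eq_1_iff: "u \<in> V \<Longrightarrow> v \<in> V \<Longrightarrow> d u v = 1 \<longleftrightarrow> (u, v) \<in> parcs G"
proof
  assume uv: "u \<in> V" "v \<in> V" "(u, v) \<in> parcs G"
  then have "d u v \<le> 1" using gdist_le[of u v 1] by simp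
  moreover have "d u v \<noteq> 0" using uv no_loops' by (auto simp: gdist_eq_0_iff)
  ultimately show "d u v = 1" by simp
qed (use relpow_gdist[of u v] in auto)

lemma gdist_step: "r \<in> V \<Longrightarrow> (u, v) \<in> parcs G \<Longrightarrow> d r v \<le> Suc (d r u)"
  using gdist_triangle[of r u v] gdist_eq_1_iff[of u v] in_arcsD1 in_arcsD2 by fastforce

lemma parent_exists:
  assumes "r \<in> V" "u \<in> V" "u \<noteq> r"
  obtains w where "(w, u) \<in> parcs G" "d r u = Suc (d r w)"
proof -
  obtain k where k: "d r u = Suc k"
    using assms by (metis gdist_eq_0_iff not0_implies_Suc)
  then obtain w where w: "(r, w) \<in> parcs G ^^ k" "(w, u) \<in> parcs G"
    using relpow_gdist[OF assms(1,2)] by auto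
  then have "d r w \<le> k" "d r u \<le> Suc (d r w)"
    using assms gdist_le gdist_step by auto
  then show ?thesis using that w k by simp
qed

lemma geodesic_exists:
  assumes "u \<in> V" "v \<in> V"
  obtains p where "awalk u p v" "length p = d u v"
  using relpow_gdist[OF assms] awalk_iff_relpow[OF assms(1)] by metis

lemma gdist_le_awalk: "awalk u p v \<Longrightarrow> d u v \<le> length p"
  using awalk_iff_relpow gdist_le awalk_hd_in_verts by blast

end

section \<open>Trees: uniqueness of the way towards a vertex\<close>

locale utree = connected_graph +
  assumes acyclic: "cycle p \<Longrightarrow> length p < 3"
begin

text \<open>The only use of acyclicity. Geodesics from such neighbours to \<open>r\<close> cannot
  pass through \<open>u\<close>; if the neighbours differed, the geodesics would yield a path that
  avoids \<open>u\<close> and closes up to a cycle at \<open>u\<close>. The comparison is not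
  strict, so neighbours on the level of \<open>u\<close> are covered too.\<close>

lemma neighbour_towards_unique:
  assumes r: "r \<in> V" and arcs: "(w1, u) \<in> parcs G" "(w2, u) \<in> parcs G"
    and close: "d r w1 \<le> d r u" "d r w2 \<le> d r u"
  shows "w1 = w2"
proof (rule ccontr)
  assume ne: "w1 \<noteq> w2"
  have avoid: "\<exists>p. awalk w p r \<and> u \<notin> set (awalk_verts w p)"
    if w: "(w, u) \<in> parcs G" "d r w \<le> d r u" for w
  proof -
    have V: "w \<in> V" "u \<in> V" using w wellformed' by auto
    obtain p where p: "awalk w p r" "length p = d w r"
      using geodesic_exists V r by blast
    have "u \<notin> set (awalk_verts w p)"
    proof
      assume "u \<in> set (awalk_verts w p)"
      then obtain q s where qs: "p = q @ s" "awalk w q u" "awalk u s r"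
        using awalk_decomp[OF p(1), of u] by blast
      \<comment> \<open>At least one arc leads from \<open>w\<close> to \<open>u\<close>, so the
        rest of the geodesic is shorter than \<open>d w r\<close>, although \<open>u\<close> is at
        least that far from \<open>r\<close>.\<close>
      have "q \<noteq> []" using qs(2) w no_loops' by (auto simp: awalk_Nil_iff)
      then have "d u r < length p"
        using gdist_le_awalk[OF qs(3)] by (cases q) (simp_all add: qs(1))
      then show False using w p V r by (simp add: gdist_sym)
    qed
    with p show ?thesis by blast
  qed
  obtain p1 p2 where p1: "awalk w1 p1 r" "u \<notin> set (awalk_verts w1 p1)"
    and p2: "awalk w2 p2 r" "u \<notin> set (awalk_verts w2 p2)"
    using avoid[OF arcs(1) close(1)] avoid[OF arcs(2) close(2)] by blast
  define q where "q = p1 @ rev_path p2"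
  have q: "awalk w1 q w2" unfolding q_def using p1 p2 by (auto intro: awalk_appendI)
  have uq: "u \<notin> fst ` set q \<union> snd ` set q"
  proof -
    have "awalk_verts r (rev_path p2) = rev (awalk_verts w2 p2)"
      using awalk_verts_rev_path[OF p2(1)] .
    moreover have "awalk r (rev_path p2) w2" using p2 by simp
    ultimately show ?thesis
      using p1 p2 set_awalk_verts[OF p1(1)] set_awalk_verts[of r "rev_path p2" w2]
      by (auto simp: q_def)
  qed
  define c where "c = awalk_to_apath q"
  have c: "apath w1 c w2" unfolding c_def by (rule apath_awalk_to_apath[OF q])
  then have "c \<noteq> []" using ne by (auto simp: apath_Nil_iff)
  have "set c \<subseteq> set q" unfolding c_def by (rule awalk_to_apath_subset[OF q])
  moreover have wc: "awalk w1 c w2" "distinct (awalk_verts w1 c)" using c by (auto simp: apath_def)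
  ultimately have uc: "u \<notin> set (awalk_verts w1 c)"
    using uq \<open>c \<noteq> []\<close> set_awalk_verts_not_Nil[OF wc(1)] by auto
  define z where "z = (u, w1) # c @ [(w2, u)]"
  have "awalk u z u"
    unfolding z_def using wc(1) arcs arcs_symmetric wellformed' by (auto simp: awalk_simps)
  moreover have "awalk_verts u z = u # awalk_verts w1 c @ [u]"
    unfolding z_def using awalk_verts_append[of w1 c "[(w2, u)]" u] wc(1) arcs
    by (auto simp: awalk_simps intro: wellformed')
  ultimately have "cycle z" using uc wc(2) by (auto simp: cycle_def z_def)
  \<comment> \<open>Going out and back along one edge is a cycle of length 2; the arc inside
    \<open>c\<close> is what rules out this harmless case.\<close>
  moreover have "length z \<ge> 3" using \<open>c \<noteq> []\<close> by (cases c) (auto simp: z_def)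
  ultimately show False using acyclic by fastforce
qed

end

lemma utreeI: "undirected_tree G \<Longrightarrow> utree G"
  by (auto simp: undirected_tree_def utree_def utree_axioms_def connected_graph_def
      connected_graph_axioms_def not_le)

section \<open>The eccentricity form\<close>

text \<open>Indexed by vertices instead of list positions, so that test vectors are functions on the
  graph.\<close>

definition ecc_form :: "'a pair_pre_digraph \<Rightarrow> ('a \<Rightarrow> real) \<Rightarrow> ('a \<Rightarrow> real) \<Rightarrow> real" where
  "ecc_form G x y = (\<Sum>u\<in>pverts G. \<Sum>v\<in>pverts G. x u * ecc_entry G u v * y v)"

lemma ecc_eigval_2: "ecc_eigval 2 G = second_eigenvalue (eccentricity_matrix G)"
  by (simp add: ecc_eigval_def second_eigenvalue_def)

text \<open>The common ground of the two uses: a tree has symmetric entries because its metric is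
  symmetric, while for the broom the explicit entries show it, without a proof that it is a
  tree.\<close>

locale finite_sym_ecc =
  fixes G :: "'a pair_pre_digraph"
  assumes finite: "finite (pverts G)" and card_ge_2: "2 \<le> card (pverts G)"
    and sym: "\<And>u v. u \<in> pverts G \<Longrightarrow> v \<in> pverts G \<Longrightarrow> ecc_entry G u v = ecc_entry G v u"
begin

text \<open>The same choice term as in \<open>eccentricity_matrix\<close>, so that \<open>M\<close>
  is literally \<open>ecc_mat G vs\<close>.\<close>

definition vs :: "'a list" where "vs = (SOME vs. distinct vs \<and> set vs = pverts G)"

lemma vs: "distinct vs" "set vs = pverts G"
proof -
  have "distinct vs \<and> set vs = pverts G"
    unfolding vs_def by (rule someI_ex) (use finite_distinct_list[OF finite] in blast)
  then show "distinct vs" "set vs = pverts G" by auto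
qed

definition vec_of :: "('a \<Rightarrow> real) \<Rightarrow> real vec" where
  "vec_of f = vec (length vs) (\<lambda>i. f (vs ! i))"

abbreviation "M \<equiv> eccentricity_matrix G"

lemma sum_vs: "(\<Sum>i<length vs. f (vs ! i)) = (\<Sum>u\<in>pverts G. f u)"
  by (rule sum.reindex_bij_betw) (use vs in \<open>auto intro: bij_betw_nth\<close>)

lemma vec_of_carrier [simp]: "vec_of f \<in> carrier_vec (length vs)"
  by (simp add: vec_of_def)

lemma M_carrier: "M \<in> carrier_mat (length vs) (length vs)"
  by (simp add: eccentricity_matrix_def ecc_mat_def vs_def)

lemma M_index: "i < length vs \<Longrightarrow> j < length vs \<Longrightarrow> M $$ (i, j) = ecc_entry G (vs ! i) (vs ! j)"
  by (simp add: eccentricity_matrix_def ecc_mat_def flip: vs_def)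

lemma M_sym: "M\<^sup>T = M"
proof (rule eq_matI)
  fix i j assume "i < dim_row M" "j < dim_col M"
  then have "i < length vs" "j < length vs" using M_carrier by auto
  then show "M\<^sup>T $$ (i, j) = M $$ (i, j)"
    using M_carrier vs(2) by (simp add: M_index) (metis nth_mem sym)
qed (use M_carrier in auto)

lemma length_vs: "2 \<le> length vs"
  using card_ge_2 vs distinct_card[OF vs(1)] by simp

lemma vec_of_scalar_prod: "vec_of f \<bullet> vec_of g = (\<Sum>u\<in>pverts G. f u * g u)"
  by (simp add: vec_of_def scalar_prod_def atLeast0LessThan sum_vs[of "\<lambda>u. f u * g u"])

lemma vec_of_form: "vec_of f \<bullet> (M *\<^sub>v vec_of g) = ecc_form G f g"
proof -
  have "M *\<^sub>v vec_of g = vec_of (\<lambda>u. \<Sum>v\<in>pverts G. ecc_entry G u v * g v)"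
  proof (rule eq_vecI)
    fix i assume "i < dim_vec (vec_of (\<lambda>u. \<Sum>v\<in>pverts G. ecc_entry G u v * g v))"
    then have i: "i < length vs" by (simp add: vec_of_def)
    have "(M *\<^sub>v vec_of g) $ i = (\<Sum>j<length vs. ecc_entry G (vs ! i) (vs ! j) * g (vs ! j))"
      using i M_carrier
      by (auto simp: vec_of_def scalar_prod_def atLeast0LessThan M_index intro!: sum.cong)
    then show "(M *\<^sub>v vec_of g) $ i = vec_of (\<lambda>u. \<Sum>v\<in>pverts G. ecc_entry G u v * g v) $ i"
      using i by (simp add: vec_of_def sum_vs[of "\<lambda>v. ecc_entry G (vs ! i) v * g v"])
  qed (use M_carrier in \<open>auto simp: vec_of_def\<close>)
  then show ?thesis
    by (simp add: vec_of_scalar_prod ecc_form_def sum_distrib_left mult.assoc)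
qed

lemma vec_of_surj:
  assumes "z \<in> carrier_vec (length vs)"
  obtains f where "z = vec_of f"
proof
  have inj: "inj_on ((!) vs) {..<length vs}"
    using vs(1) by (intro inj_on_nth) auto
  show "z = vec_of (\<lambda>u. z $ the_inv_into {..<length vs} ((!) vs) u)"
    using assms by (intro eq_vecI) (simp_all add: vec_of_def the_inv_into_f_f[OF inj])
qed

lemma form_sym: "ecc_form G f g = ecc_form G g f"
proof -
  have "ecc_form G f g = (\<Sum>v\<in>pverts G. \<Sum>u\<in>pverts G. f u * ecc_entry G u v * g v)"
    unfolding ecc_form_def by (rule sum.swap)
  also have "\<dots> = ecc_form G g f"
    unfolding ecc_form_def
  proof (intro sum.cong refl)
    fix v u assume "v \<in> pverts G" "u \<in> pverts G"
    then show "f u * ecc_entry G u v * g v = g v * ecc_entry G v u * f u"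
      using sym[of u v] by simp
  qed
  finally show ?thesis .
qed

lemma form_combination:
  "ecc_form G (\<lambda>u. r * x u + s * y u) (\<lambda>u. r * x u + s * y u)
    = r\<^sup>2 * ecc_form G x x + 2 * r * s * ecc_form G x y + s\<^sup>2 * ecc_form G y y"
proof -
  have "ecc_form G (\<lambda>u. r * x u + s * y u) (\<lambda>u. r * x u + s * y u)
    = r\<^sup>2 * ecc_form G x x + r * s * ecc_form G x y + r * s * ecc_form G y x + s\<^sup>2 * ecc_form G y y"
    unfolding ecc_form_def sum_distrib_left sum.distrib[symmetric]
    by (intro sum.cong refl) (simp add: algebra_simps power2_eq_square)
  then show ?thesis using form_sym[of x y] by simp
qed

text \<open>With both cross terms zero, squared norm and form are diagonal on the plane spanned by
  \<open>x\<close> and \<open>y\<close>, so the two quotients bound the form on all of it.\<close>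

lemma ecc_eigval_ge:
  assumes orth: "(\<Sum>u\<in>pverts G. x u * y u) = 0" "ecc_form G x y = 0"
    and pos: "(\<Sum>u\<in>pverts G. (x u)\<^sup>2) > 0" "(\<Sum>u\<in>pverts G. (y u)\<^sup>2) > 0"
    and form: "c * (\<Sum>u\<in>pverts G. (x u)\<^sup>2) \<le> ecc_form G x x"
      "c * (\<Sum>u\<in>pverts G. (y u)\<^sup>2) \<le> ecc_form G y y"
  shows "c \<le> ecc_eigval 2 G"
  unfolding ecc_eigval_2
proof (rule second_eigenvalue_ge[OF M_carrier M_sym length_vs])
  show "vec_of x \<in> carrier_vec (length vs)" "vec_of y \<in> carrier_vec (length vs)" by simp_all
  have comb: "r \<cdot>\<^sub>v vec_of x + s \<cdot>\<^sub>v vec_of y = vec_of (\<lambda>u. r * x u + s * y u)" for r s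
    by (rule eq_vecI) (auto simp: vec_of_def)
  have norm: "vec_of (\<lambda>u. r * x u + s * y u) \<bullet> vec_of (\<lambda>u. r * x u + s * y u)
    = r\<^sup>2 * (\<Sum>u\<in>pverts G. (x u)\<^sup>2) + s\<^sup>2 * (\<Sum>u\<in>pverts G. (y u)\<^sup>2)" for r s
  proof -
    have "(\<Sum>u\<in>pverts G. (r * x u + s * y u) * (r * x u + s * y u)) = r\<^sup>2 * (\<Sum>u\<in>pverts G. (x u)\<^sup>2)
        + 2 * r * s * (\<Sum>u\<in>pverts G. x u * y u) + s\<^sup>2 * (\<Sum>u\<in>pverts G. (y u)\<^sup>2)"
      unfolding sum_distrib_left sum.distrib[symmetric]
      by (intro sum.cong refl) (simp add: algebra_simps power2_eq_square)
    then show ?thesis by (simp add: vec_of_scalar_prod orth)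
  qed
  fix r s
  {
    assume "r \<cdot>\<^sub>v vec_of x + s \<cdot>\<^sub>v vec_of y = 0\<^sub>v (length vs)"
    then have "r\<^sup>2 * (\<Sum>u\<in>pverts G. (x u)\<^sup>2) + s\<^sup>2 * (\<Sum>u\<in>pverts G. (y u)\<^sup>2) = 0"
      using norm[of r s] by (simp add: comb)
    moreover have "0 \<le> r\<^sup>2 * (\<Sum>u\<in>pverts G. (x u)\<^sup>2)" "0 \<le> s\<^sup>2 * (\<Sum>u\<in>pverts G. (y u)\<^sup>2)"
      using pos by simp_all
    ultimately have "r\<^sup>2 * (\<Sum>u\<in>pverts G. (x u)\<^sup>2) = 0" "s\<^sup>2 * (\<Sum>u\<in>pverts G. (y u)\<^sup>2) = 0"
      by linarith+
    then show "r = 0 \<and> s = 0" using pos by simp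
  }
  fix z assume z: "z = r \<cdot>\<^sub>v vec_of x + s \<cdot>\<^sub>v vec_of y"
  have "c * (z \<bullet> z) = r\<^sup>2 * (c * (\<Sum>u\<in>pverts G. (x u)\<^sup>2)) + s\<^sup>2 * (c * (\<Sum>u\<in>pverts G. (y u)\<^sup>2))"
    unfolding z comb norm by (simp add: algebra_simps)
  also have "\<dots> \<le> r\<^sup>2 * ecc_form G x x + s\<^sup>2 * ecc_form G y y"
    using form by (intro add_mono mult_left_mono) auto
  also have "\<dots> = z \<bullet> (M *\<^sub>v z)"
    unfolding z comb vec_of_form form_combination by (simp add: orth)
  finally show "c * (z \<bullet> z) \<le> z \<bullet> (M *\<^sub>v z)" .
qed

lemma ecc_eigval_less:
  assumes "\<And>z. (\<exists>u\<in>pverts G. z u \<noteq> 0) \<Longrightarrow> (\<Sum>u\<in>pverts G. w u * z u) = 0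
    \<Longrightarrow> ecc_form G z z < c * (\<Sum>u\<in>pverts G. (z u)\<^sup>2)"
  shows "ecc_eigval 2 G < c"
  unfolding ecc_eigval_2
proof (rule second_eigenvalue_less[OF M_carrier M_sym length_vs])
  show "vec_of w \<in> carrier_vec (length vs)" by simp
  fix z assume z: "z \<in> carrier_vec (length vs)" "z \<noteq> 0\<^sub>v (length vs)" "vec_of w \<bullet> z = 0"
  obtain f where f: "z = vec_of f" using vec_of_surj[OF z(1)] .
  have "\<exists>u\<in>pverts G. f u \<noteq> 0"
  proof (rule ccontr)
    assume "\<not> ?thesis"
    then have "z = 0\<^sub>v (length vs)"
      unfolding f using vs(2) by (intro eq_vecI) (auto simp: vec_of_def)
    with z(2) show False ..
  qed
  then have "ecc_form G f f < c * (\<Sum>u\<in>pverts G. (f u)\<^sup>2)"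
    using z(3) assms by (simp add: f vec_of_scalar_prod)
  then show "z \<bullet> (M *\<^sub>v z) < c * (z \<bullet> z)"
    by (simp add: f vec_of_form vec_of_scalar_prod power2_eq_square)
qed

end

text \<open>Listing the vertices of \<open>H\<close> as the image of the list chosen for
  \<open>G\<close> gives the same matrix entry by entry. The list chosen for \<open>H\<close> may be
  in a different order, which does not affect the characteristic polynomial.\<close>

lemma ecc_eigval_iso:
  assumes G: "pair_wf_digraph G" "finite (pverts G)" and H: "pair_wf_digraph H"
    and inj: "inj_on h (pverts G)" and verts: "pverts H = h ` pverts G"
    and arcs: "parcs H = map_prod h h ` parcs G"
  shows "ecc_eigval k G = ecc_eigval k H"
proof -
  note dist = gdist_iso[OF G(1) H inj verts arcs]
  have ecc: "eccentricity H (h u) = eccentricity G u" if "u \<in> pverts G" for u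
    unfolding eccentricity_def verts image_image using that by (simp add: dist cong: image_cong)
  have entry: "ecc_entry H (h u) (h v) = ecc_entry G u v" if "u \<in> pverts G" "v \<in> pverts G" for u v
    using that by (simp add: ecc_entry_def dist ecc)
  define vs where "vs = (SOME vs. distinct vs \<and> set vs = pverts G)"
  define ws where "ws = (SOME ws. distinct ws \<and> set ws = pverts H)"
  have vs: "distinct vs \<and> set vs = pverts G"
    unfolding vs_def by (rule someI_ex) (use finite_distinct_list[OF G(2)] in blast)
  have "finite (pverts H)" using G(2) verts by simp
  then have ws: "distinct ws \<and> set ws = pverts H"
    unfolding ws_def by - (rule someI_ex, use finite_distinct_list in blast)
  have "vs ! i \<in> pverts G" if "i < length vs" for i
    using vs that by (metis nth_mem)
  then have "ecc_mat G vs = ecc_mat H (map h vs)"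
    by (intro eq_matI) (auto simp: ecc_mat_def entry)
  moreover have "char_poly (ecc_mat H (map h vs)) = char_poly (ecc_mat H ws)"
    using vs ws inj verts by (intro char_poly_ecc_mat_cong) (auto simp: distinct_map)
  ultimately show ?thesis
    by (simp add: ecc_eigval_def eccentricity_matrix_def flip: vs_def ws_def)
qed

section \<open>The broom\<close>

context
  fixes n :: nat
  assumes n: "4 \<le> n"
begin

lemma broom_verts [simp]: "pverts (broom n) = {..<n}"
  by (simp add: broom_def)

lemma broom_arcs_iff:
  "(x, y) \<in> parcs (broom n) \<longleftrightarrow> x = 0 \<and> y = 1 \<or> x = 1 \<and> y = 0 \<or> x = 1 \<and> y = 2 \<or> x = 2 \<and> y = 1
    \<or> x = 2 \<and> 3 \<le> y \<and> y < n \<or> y = 2 \<and> 3 \<le> x \<and> x < n"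
  using n by (auto simp: broom_def broom_edges_def)

lemma pair_wf_digraph_broom: "pair_wf_digraph (broom n)"
  using n by unfold_locales (auto simp: broom_arcs_iff)

text \<open>\<open>min _ 3\<close> folds all leaves at 2 onto position 3 of the path, vertex 3 being
  one of them. The two truncated differences add up to the distance of the positions, since one of
  them is always 0.\<close>

definition broom_dist :: "nat \<Rightarrow> nat \<Rightarrow> nat" where
  "broom_dist u v = (if u = v then 0 else if 3 \<le> u \<and> 3 \<le> v then 2
    else (min u 3 - min v 3) + (min v 3 - min u 3))"

lemma gdist_broom:
  assumes "u < n" "v < n"
  shows "gdist (broom n) u v = broom_dist u v"
proof -
  interpret pair_wf_digraph "broom n" by (rule pair_wf_digraph_broom)
  show ?thesis
  proof (rule gdist_eqI)
    show "u \<in> pverts (broom n)" "v \<in> pverts (broom n)" "broom_dist u u = 0"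
      using assms by (auto simp: broom_dist_def)
    show "broom_dist u y \<le> Suc (broom_dist u x)" if "(x, y) \<in> parcs (broom n)" for x y
      using that unfolding broom_arcs_iff broom_dist_def min_def by (auto split: if_splits)
  next
    fix y assume y: "y \<in> pverts (broom n)" "y \<noteq> u"
    \<comment> \<open>The neighbour of \<open>y\<close> one step closer to \<open>u\<close>: a leaf
      at 2 is left towards 2, from 2 a leaf \<open>u\<close> is reached at once, and otherwise the
      path is followed.\<close>
    define x where "x = (if 3 \<le> y then 2 else if y = 2 \<and> 3 \<le> u then u else if y < u then Suc y else y - 1)"
    consider "y = 0" | "y = 1" | "y = 2" "3 \<le> u" | "y = 2" "u \<le> 1" | "3 \<le> y"
      using y by fastforce
    then have "(x, y) \<in> parcs (broom n) \<and> broom_dist u y = Suc (broom_dist u x)"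
      using y assms n by cases (auto simp: broom_arcs_iff x_def broom_dist_def min_def)
    then show "\<exists>x. (x, y) \<in> parcs (broom n) \<and> broom_dist u y = Suc (broom_dist u x)" ..
  qed
qed

lemma eccentricity_broom:
  assumes "u < n"
  shows "eccentricity (broom n) u = (if u = 1 \<or> u = 2 then 2 else 3)"
  unfolding eccentricity_def
proof (rule Max_eqI)
  show "(if u = 1 \<or> u = 2 then 2 else 3) \<in> gdist (broom n) u ` pverts (broom n)"
  proof
    show "(if u = 1 \<or> u = 2 then 2 else 3) = gdist (broom n) u (if u = 0 \<or> u = 1 then 3 else 0)"
      using assms n by (subst gdist_broom) (auto simp: broom_dist_def min_def)
  qed (use n in auto)
next
  fix y assume "y \<in> gdist (broom n) u ` pverts (broom n)"
  then show "y \<le> (if u = 1 \<or> u = 2 then 2 else 3)"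
    using assms by (auto simp: gdist_broom broom_dist_def min_def)
qed simp

lemma ecc_entry_broom:
  assumes "u < n" "v < n"
  shows "ecc_entry (broom n) u v =
    (if u = 0 \<and> 3 \<le> v \<or> v = 0 \<and> 3 \<le> u then 3
     else if u = 0 \<and> v = 2 \<or> u = 2 \<and> v = 0 \<or> u = 1 \<and> 3 \<le> v \<or> v = 1 \<and> 3 \<le> u then 2 else 0)"
  using assms by (auto simp: ecc_entry_def eccentricity_broom gdist_broom broom_dist_def)

lemma sum_broom: "(\<Sum>u<n. f u) = f 0 + f 1 + f 2 + (\<Sum>u\<in>{3..<n}. f u)" for f :: "nat \<Rightarrow> real"
proof -
  have "{..<n} = {0, 1, 2} \<union> {3..<n}" using n by auto
  then show ?thesis by (simp add: sum.union_disjoint)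
qed

end

text \<open>The vertices from 3 on have equal rows and zero entries among themselves, so the form
  sees only their sum. Among 0, 1 and 2 only the pair 0, 2 contributes.\<close>

lemma ecc_form_broom:
  assumes n: "4 \<le> n"
  shows "ecc_form (broom n) z z
    = 4 * z 0 * z 2 + 2 * (3 * z 0 + 2 * z 1) * (\<Sum>u\<in>{3..<n}. z u)"
proof -
  define L where "L = (\<Sum>u\<in>{3..<n}. z u)"
  have row: "(\<Sum>v<n. z u * ecc_entry (broom n) u v * z v) = z u *
      (if u = 0 then 2 * z 2 + 3 * L else if u = 1 then 2 * L else if u = 2 then 2 * z 0
       else 3 * z 0 + 2 * z 1)" if "u < n" for u
  proof -
    consider "u = 0" | "u = 1" | "u = 2" | "3 \<le> u" by linarith
    then show ?thesis
      using that n
      by cases (simp_all add: sum_broom[OF n] ecc_entry_broom[OF n] L_def sum_distrib_left algebra_simps)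
  qed
  have "ecc_form (broom n) z z = (\<Sum>u<n. z u *
      (if u = 0 then 2 * z 2 + 3 * L else if u = 1 then 2 * L else if u = 2 then 2 * z 0
       else 3 * z 0 + 2 * z 1))"
    unfolding ecc_form_def using n by (simp add: row)
  also have "\<dots> = z 0 * (2 * z 2 + 3 * L) + z 1 * (2 * L) + z 2 * (2 * z 0) + L * (3 * z 0 + 2 * z 1)"
    by (simp add: sum_broom[OF n] L_def sum_distrib_right)
  finally show ?thesis by (simp add: L_def algebra_simps)
qed

text \<open>On the hyperplane the sum over the vertices from 3 on drops out of the form, which
  leaves \<open>4 * z 0 * z 2\<close> against a squared norm of at least
  \<open>13 / 4 * (z 0)\<^sup>2 + (z 2)\<^sup>2\<close>. This is why one bound serves all
  \<open>n\<close>.\<close>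

lemma ecc_eigval_broom_less:
  assumes n: "4 \<le> n"
  shows "ecc_eigval 2 (broom n) < 10 / 9"
proof -
  interpret finite_sym_ecc "broom n"
    using n by unfold_locales (auto simp: ecc_entry_broom)
  show ?thesis
    \<comment> \<open>The term \<open>3 * z 0 + 2 * z 1\<close> is the coefficient of the pendant vertices in the form.\<close>
  proof (rule ecc_eigval_less[where w = "\<lambda>u. if u = 0 then 3 else if u = 1 then 2 else 0"])
    fix z :: "nat \<Rightarrow> real"
    assume ex: "\<exists>u\<in>pverts (broom n). z u \<noteq> 0"
      and "(\<Sum>u\<in>pverts (broom n). (if u = 0 then 3 else if u = 1 then 2 else 0) * z u) = 0"
    then have z1: "3 * z 0 + 2 * z 1 = 0"
      using n by (simp add: sum_broom)
    define S where "S = (\<Sum>u\<in>{3..<n}. (z u)\<^sup>2)"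
    have S: "0 \<le> S" by (simp add: S_def sum_nonneg)
    have norm: "(\<Sum>u\<in>pverts (broom n). (z u)\<^sup>2) = (z 0)\<^sup>2 + (z 1)\<^sup>2 + (z 2)\<^sup>2 + S"
      using n by (simp add: sum_broom S_def)
    have "z 1 = - 3 / 2 * z 0" using z1 by simp
    \<comment> \<open>After \<open>z 1\<close> is eliminated, the square is completed in
      \<open>z 2\<close>; 13/4 - (9/5)^2 = 1/100 is all that remains as coefficient of the square of
      \<open>z 0\<close>.\<close>
    then have gap: "10 / 9 * ((z 0)\<^sup>2 + (z 1)\<^sup>2 + (z 2)\<^sup>2 + S) - 4 * z 0 * z 2
      = 10 / 9 * ((z 2 - 9 / 5 * z 0)\<^sup>2 + 1 / 100 * (z 0)\<^sup>2 + S)"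
      by (simp add: power2_eq_square algebra_simps)
    have "(z 2 - 9 / 5 * z 0)\<^sup>2 + 1 / 100 * (z 0)\<^sup>2 + S \<noteq> 0"
    proof
      assume "(z 2 - 9 / 5 * z 0)\<^sup>2 + 1 / 100 * (z 0)\<^sup>2 + S = 0"
      then have "S = 0" "(z 2 - 9 / 5 * z 0)\<^sup>2 = 0" "(z 0)\<^sup>2 = 0"
        using S zero_le_power2[of "z 0"] zero_le_power2[of "z 2 - 9 / 5 * z 0"] by linarith+
      then have "z 0 = 0" "z 1 = 0" "z 2 = 0" "\<forall>u\<in>{3..<n}. z u = 0"
        using z1 by (auto simp: S_def sum_nonneg_eq_0_iff)
      moreover obtain u where u: "u < n" "z u \<noteq> 0" using ex n by auto
      moreover have "u = 0 \<or> u = 1 \<or> u = 2 \<or> u \<in> {3..<n}" using u by auto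
      ultimately show False by auto
    qed
    then have "0 < (z 2 - 9 / 5 * z 0)\<^sup>2 + 1 / 100 * (z 0)\<^sup>2 + S"
      using S by (simp add: add_nonneg_nonneg order_less_le)
    then have "0 < 10 / 9 * ((z 0)\<^sup>2 + (z 1)\<^sup>2 + (z 2)\<^sup>2 + S) - 4 * z 0 * z 2"
      unfolding gap by simp
    then have "4 * z 0 * z 2 < 10 / 9 * ((z 0)\<^sup>2 + (z 1)\<^sup>2 + (z 2)\<^sup>2 + S)"
      by (simp only: diff_gt_0_iff_gt)
    then show "ecc_form (broom n) z z < 10 / 9 * (\<Sum>u\<in>pverts (broom n). (z u)\<^sup>2)"
      unfolding norm ecc_form_broom[OF n] z1 by simp
  qed
qed

section \<open>Trees that are not stars\<close>

lemma digraph_isoI: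
  assumes "pair_wf_digraph G" "inj_on h (pverts G)" "pverts H = h ` pverts G"
    "parcs H = map_prod h h ` parcs G"
  shows "digraph_iso (with_proj G) (with_proj H)"
proof -
  interpret pair_wf_digraph G by fact
  define f where "f = \<lparr>iso_verts = h, iso_arcs = map_prod h h, iso_head = snd, iso_tail = fst\<rparr>"
  have "inj_on (map_prod h h) (pverts G \<times> pverts G)"
    by (rule map_prod_inj_on) fact+
  moreover have "parcs G \<subseteq> pverts G \<times> pverts G"
    using in_arcsD1 in_arcsD2 by auto
  ultimately have "inj_on (map_prod h h) (parcs G)"
    by (rule inj_on_subset)
  then have "pre_digraph.digraph_isomorphism (with_proj G) f"
    using assms(1,2) by (auto simp: pre_digraph.digraph_isomorphism_def f_def wf_digraph_wp_iff)
  moreover have "with_proj H = app_iso f (with_proj G)"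
    using assms(3,4) by (simp add: app_iso_def f_def with_proj_def)
  ultimately show ?thesis unfolding digraph_iso_def by blast
qed

lemma digraph_isoE:
  assumes "digraph_iso (with_proj G) (with_proj H)"
  obtains h where "inj_on h (pverts G)" "pverts H = h ` pverts G" "parcs H = map_prod h h ` parcs G"
proof -
  obtain f where f: "pre_digraph.digraph_isomorphism (with_proj G) f"
    and H: "with_proj H = app_iso f (with_proj G)"
    using assms unfolding digraph_iso_def by blast
  have iso: "iso_head f = snd" "iso_tail f = fst" "pverts H = iso_verts f ` pverts G"
    "parcs H = iso_arcs f ` parcs G"
    using H by (auto simp: app_iso_def with_proj_def)
  have arcs: "iso_arcs f e = map_prod (iso_verts f) (iso_verts f) e" if "e \<in> parcs G" for e
    using f that iso unfolding pre_digraph.digraph_isomorphism_def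
    by (simp add: prod_eq_iff)
  show ?thesis
  proof (rule that[of "iso_verts f"])
    show "inj_on (iso_verts f) (pverts G)"
      using f by (simp add: pre_digraph.digraph_isomorphism_def)
    show "pverts H = iso_verts f ` pverts G" by (rule iso(3))
    show "parcs H = map_prod (iso_verts f) (iso_verts f) ` parcs G"
      unfolding iso(4) using arcs by (rule image_cong[OF refl])
  qed
qed

lemma ecc_form_support:
  assumes "finite (pverts G)" "S \<subseteq> pverts G" "\<And>u. u \<notin> S \<Longrightarrow> x u = 0" "\<And>u. u \<notin> S \<Longrightarrow> y u = 0"
  shows "ecc_form G x y = (\<Sum>u\<in>S. \<Sum>v\<in>S. x u * ecc_entry G u v * y v)"
proof -
  have "ecc_form G x y = (\<Sum>u\<in>S. \<Sum>v\<in>pverts G. x u * ecc_entry G u v * y v)"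
    unfolding ecc_form_def using assms by (intro sum.mono_neutral_right) auto
  also have "\<dots> = (\<Sum>u\<in>S. \<Sum>v\<in>S. x u * ecc_entry G u v * y v)"
    using assms by (intro sum.cong refl sum.mono_neutral_right) auto
  finally show ?thesis .
qed

context connected_graph
begin

lemma ecc_entry_sym: "u \<in> V \<Longrightarrow> v \<in> V \<Longrightarrow> ecc_entry G u v = ecc_entry G v u"
  by (simp add: ecc_entry_def gdist_sym min.commute)

lemma ecc_entry_self: "u \<in> V \<Longrightarrow> ecc_entry G u u = 0"
  by (simp add: ecc_entry_def)

lemma eccentricityI:
  assumes "v \<in> V" "d u v = k" "\<And>w. w \<in> V \<Longrightarrow> d u w \<le> k"
  shows "eccentricity G u = k"
  unfolding eccentricity_def using assms pair_finite_verts by (intro Max_eqI) auto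

lemma diametral_pair:
  obtains a b where "a \<in> V" "b \<in> V" "\<And>u v. u \<in> V \<Longrightarrow> v \<in> V \<Longrightarrow> d u v \<le> d a b"
proof -
  let ?D = "(\<lambda>(u, v). d u v) ` (V \<times> V)"
  have fin: "finite ?D" "?D \<noteq> {}" using pair_finite_verts verts_nonempty by auto
  obtain a b where ab: "a \<in> V" "b \<in> V" "d a b = Max ?D"
    using Max_in[OF fin] by auto
  moreover have "d u v \<le> Max ?D" if "u \<in> V" "v \<in> V" for u v
    using fin(1) that by (intro Max_ge) auto
  ultimately show ?thesis using that by auto
qed

end

section \<open>Levels, stars and leaves in a tree\<close>

context utree
begin

text \<open>Otherwise \<open>u\<close> and the parent of \<open>v\<close> would both be neighbours
  of \<open>v\<close> no farther from \<open>r\<close>, hence equal, although the parent is strictly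
  closer.\<close>

lemma no_equal_levels:
  assumes r: "r \<in> V" and uv: "(u, v) \<in> parcs G"
  shows "d r u \<noteq> d r v"
proof
  assume eq: "d r u = d r v"
  have V: "u \<in> V" "v \<in> V" using uv wellformed' by auto
  have "v \<noteq> r"
    using eq uv V r gdist_eq_0_iff[of r u] no_loops' by auto
  then obtain w where w: "(w, v) \<in> parcs G" "d r v = Suc (d r w)"
    using parent_exists r V(2) by blast
  then have "w = u" using neighbour_towards_unique[OF r w(1) uv] eq by simp
  then show False using w(2) eq by simp
qed

text \<open>Seen from \<open>q\<close>, the only neighbour of \<open>p\<close> not farther than
  \<open>p\<close> is \<open>q\<close> itself, so \<open>x\<close> lies one step beyond
  \<open>p\<close>.\<close>

lemma gdist_sides:
  assumes pq: "(p, q) \<in> parcs G" and x: "(x, p) \<in> parcs G" "x \<noteq> q"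
  shows "d q x = 2"
proof -
  have V: "p \<in> V" "q \<in> V" "x \<in> V" using assms wellformed' by auto
  have "d q p = 1" using pq V arcs_symmetric gdist_eq_1_iff by blast
  then have "d q x \<le> 2" using gdist_step[OF V(2) arcs_symmetric[OF x(1)]] by simp
  moreover have "\<not> d q x \<le> d q p"
    using neighbour_towards_unique[OF V(2) x(1) arcs_symmetric[OF pq]] x(2) V \<open>d q p = 1\<close> by auto
  ultimately show ?thesis using \<open>d q p = 1\<close> by simp
qed

text \<open>Seen from \<open>x\<close>, the only neighbour of \<open>q\<close> not farther than
  \<open>q\<close> is \<open>p\<close>, so \<open>y\<close> lies one step beyond
  \<open>q\<close>.\<close>

lemma gdist_across:
  assumes pq: "(p, q) \<in> parcs G" and x: "(x, p) \<in> parcs G" "x \<noteq> q" and y: "(y, q) \<in> parcs G" "y \<noteq> p"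
  shows "d x y = 3"
proof -
  have V: "p \<in> V" "q \<in> V" "x \<in> V" "y \<in> V" using assms wellformed' by auto
  have xq: "d x q = 2" using gdist_sides[OF pq x] gdist_sym V by simp
  have xp: "d x p = 1" using x(1) V gdist_eq_1_iff by simp
  have "d x y \<le> 3" using gdist_step[OF V(3) arcs_symmetric[OF y(1)]] xq by simp
  moreover have "\<not> d x y \<le> d x q"
    using neighbour_towards_unique[OF V(3) y(1) pq] y(2) xp xq by auto
  ultimately show ?thesis using xq by simp
qed

text \<open>The centre is the middle \<open>c\<close> of a geodesic of length 2 from
  \<open>a\<close> to \<open>b\<close>. A vertex at distance 2 from \<open>c\<close> would have both
  \<open>a\<close> and \<open>b\<close> no farther away than \<open>c\<close>, which uniqueness
  forbids; an arc avoiding \<open>c\<close> would join vertices on one level.\<close>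

lemma diameter_le_2_imp_star:
  assumes diam: "\<And>u v. u \<in> V \<Longrightarrow> v \<in> V \<Longrightarrow> d u v \<le> 2" and card: "3 \<le> card V"
  shows "complete_bipartite_digraph 1 (card V - 1) (with_proj G)"
proof -
  \<comment> \<open>Without a pair at distance 2 the graph would be complete, and three of its
    vertices would form a triangle.\<close>
  have "\<exists>a\<in>V. \<exists>b\<in>V. d a b = 2"
  proof (rule ccontr)
    assume no: "\<not> ?thesis"
    have adj: "(u, v) \<in> parcs G" if "u \<in> V" "v \<in> V" "u \<noteq> v" for u v
    proof -
      have "d u v \<le> 2" "d u v \<noteq> 2" "d u v \<noteq> 0" using diam no that gdist_eq_0_iff by auto
      then have "d u v = 1" by linarith
      then show ?thesis using that gdist_eq_1_iff by blast
    qed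
    have "\<not> V \<subseteq> {x, y}" for x y
      using card card_mono[of "{x, y}" V] by (auto simp: card_insert_if split: if_splits)
    then obtain x y z where xyz: "x \<in> V" "y \<in> V" "z \<in> V" "y \<noteq> x" "z \<noteq> x" "z \<noteq> y"
      using verts_nonempty by blast
    then have "d x y = 1" "d x z = 1" using adj gdist_eq_1_iff by simp_all
    then show False using no_equal_levels[of x y z] adj xyz by auto
  qed
  then obtain a b where ab: "a \<in> V" "b \<in> V" "d a b = 2" by blast
  then have "b \<noteq> a" by auto
  then obtain c where c: "(c, b) \<in> parcs G" "d a b = Suc (d a c)"
    using parent_exists ab by blast
  have cV: "c \<in> V" using c wellformed' by auto
  then have ac: "(a, c) \<in> parcs G" using c(2) ab gdist_eq_1_iff by auto
  have centre: "(x, c) \<in> parcs G" if "x \<in> V" "x \<noteq> c" for x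
  proof -
    have "d x c \<noteq> 2"
      using neighbour_towards_unique[OF that(1) ac arcs_symmetric[OF c(1)]] diam that ab \<open>b \<noteq> a\<close> by auto
    moreover have "d x c \<le> 2" "d x c \<noteq> 0" using diam that cV gdist_eq_0_iff by auto
    ultimately have "d x c = 1" by linarith
    then show ?thesis using that cV gdist_eq_1_iff by blast
  qed
  have "u = c \<or> v = c" if "(u, v) \<in> parcs G" for u v
  proof (rule ccontr)
    assume "\<not> ?thesis"
    moreover have "u \<in> V" "v \<in> V" using that wellformed' by auto
    ultimately have "d c u = 1" "d c v = 1"
      using centre arcs_symmetric cV gdist_eq_1_iff by auto
    then show False using no_equal_levels[OF cV that] by simp
  qed
  then have "parcs G \<subseteq> {c} \<times> (V - {c}) \<union> (V - {c}) \<times> {c}"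
    using no_loops' in_arcsD1 in_arcsD2 by fast
  moreover have "{c} \<times> (V - {c}) \<union> (V - {c}) \<times> {c} \<subseteq> parcs G"
    using centre arcs_symmetric by fast
  ultimately have arcs: "parcs G = {c} \<times> (V - {c}) \<union> (V - {c}) \<times> {c}"
    by (rule equalityI)
  show ?thesis
    unfolding complete_bipartite_digraph_pair_def
  proof (intro conjI exI)
    show "V = {c} \<union> (V - {c})" "{c} \<inter> (V - {c}) = {}" "card {c} = 1" "card (V - {c}) = card V - 1"
      using cV by auto
  qed (fact pair_finite_verts arcs)+
qed

lemma ecc_eigval_ge_support:
  assumes V2: "2 \<le> card V" and S: "S \<subseteq> V"
    and supp: "\<And>u. u \<notin> S \<Longrightarrow> x u = 0" "\<And>u. u \<notin> S \<Longrightarrow> y u = 0"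
    and orth: "(\<Sum>u\<in>S. x u * y u) = 0" "(\<Sum>u\<in>S. \<Sum>v\<in>S. x u * ecc_entry G u v * y v) = 0"
    and pos: "(\<Sum>u\<in>S. (x u)\<^sup>2) > 0" "(\<Sum>u\<in>S. (y u)\<^sup>2) > 0"
    and form: "c * (\<Sum>u\<in>S. (x u)\<^sup>2) \<le> (\<Sum>u\<in>S. \<Sum>v\<in>S. x u * ecc_entry G u v * x v)"
      "c * (\<Sum>u\<in>S. (y u)\<^sup>2) \<le> (\<Sum>u\<in>S. \<Sum>v\<in>S. y u * ecc_entry G u v * y v)"
  shows "c \<le> ecc_eigval 2 G"
proof -
  interpret finite_sym_ecc G
    using V2 pair_finite_verts ecc_entry_sym by unfold_locales auto
  have sums: "(\<Sum>u\<in>V. f u) = (\<Sum>u\<in>S. f u)" if "\<And>u. u \<notin> S \<Longrightarrow> f u = 0" for f :: "'a \<Rightarrow> real"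
    using S that pair_finite_verts by (intro sum.mono_neutral_right) auto
  note fs = ecc_form_support[OF pair_finite_verts S]
  have eqs: "(\<Sum>u\<in>V. x u * y u) = (\<Sum>u\<in>S. x u * y u)" "(\<Sum>u\<in>V. (x u)\<^sup>2) = (\<Sum>u\<in>S. (x u)\<^sup>2)"
    "(\<Sum>u\<in>V. (y u)\<^sup>2) = (\<Sum>u\<in>S. (y u)\<^sup>2)"
    using supp by (auto intro!: sums)
  show ?thesis
    by (rule ecc_eigval_ge[where x = x and y = y])
      (simp_all add: eqs fs[OF supp] fs[OF supp(1) supp(1)] fs[OF supp(2) supp(2)] assms)
qed

text \<open>By maximality no neighbour of \<open>a\<close> is farther from \<open>b\<close> than
  \<open>a\<close> is, so there is only one neighbour: \<open>a\<close> is a leaf, and all geodesics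
  from it start through \<open>a'\<close>.\<close>

lemma diametral_end:
  assumes ab: "a \<in> V" "b \<in> V" "a \<noteq> b" and max: "\<And>u v. u \<in> V \<Longrightarrow> v \<in> V \<Longrightarrow> d u v \<le> d a b"
  shows "\<exists>a'. (a', a) \<in> parcs G \<and> (\<forall>w. (w, a) \<in> parcs G \<longrightarrow> w = a')
    \<and> (\<forall>u\<in>V. u \<noteq> a \<longrightarrow> d a u = Suc (d a' u))"
proof -
  obtain a' where a': "(a', a) \<in> parcs G" "d b a = Suc (d b a')"
    using parent_exists ab by blast
  have leaf: "w = a'" if w: "(w, a) \<in> parcs G" for w
    using neighbour_towards_unique[OF ab(2) w a'(1)] a'(2) max[OF ab(2) in_arcsD1[OF w]] gdist_sym[OF ab(1,2)]
    by simp
  have "d a u = Suc (d a' u)" if u: "u \<in> V" "u \<noteq> a" for u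
  proof -
    obtain w where w: "(w, a) \<in> parcs G" "d u a = Suc (d u w)"
      using parent_exists[OF u(1) ab(1)] u(2) by blast
    then show ?thesis
      using leaf[OF w(1)] gdist_sym[OF u(1) ab(1)] gdist_sym[OF u(1) in_arcsD1[OF w(1)]] by simp
  qed
  with a'(1) leaf show ?thesis by blast
qed

end

section \<open>The two ends of a longest path\<close>

locale diametral_tree = utree +
  fixes a b a' b' :: 'a
  assumes ab: "a \<in> V" "b \<in> V" and max: "\<And>u v. u \<in> V \<Longrightarrow> v \<in> V \<Longrightarrow> d u v \<le> d a b"
    and diam: "3 \<le> d a b"
    and a': "(a', a) \<in> parcs G" "\<And>w. (w, a) \<in> parcs G \<Longrightarrow> w = a'"
      "\<And>u. u \<in> V \<Longrightarrow> u \<noteq> a \<Longrightarrow> d a u = Suc (d a' u)"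
    and b': "(b', b) \<in> parcs G" "\<And>w. (w, b) \<in> parcs G \<Longrightarrow> w = b'"
      "\<And>u. u \<in> V \<Longrightarrow> u \<noteq> b \<Longrightarrow> d b u = Suc (d b' u)"
begin

text \<open>Facts proved at the end \<open>a\<close> transfer to \<open>b\<close> through this
  symmetry.\<close>

lemma swap: "diametral_tree G b a b' a'"
proof -
  have "d a b = d b a" by (rule gdist_sym[OF ab])
  note max' = max[unfolded this] and diam' = diam[unfolded this]
  show ?thesis
    by unfold_locales (fact ab max' diam' a' b')+
qed

lemma inner: "a' \<in> V" "b' \<in> V"
  using a'(1) b'(1) wellformed' by auto

lemma dist:
  "d a a' = 1" "d b b' = 1" "d b a = d a b"
  "d a' b = d a b - 1" "d a b' = d a b - 1" "d a' b' = d a b - 2"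
  "d b a' = d a b - 1" "d b' a = d a b - 1" "d b' a' = d a b - 2"
proof -
  show 1: "d a a' = 1" "d b b' = 1"
    using ab inner a'(1) b'(1) gdist_eq_1_iff arcs_symmetric by auto
  show 2: "d b a = d a b" using gdist_sym ab by simp
  have "a \<noteq> b" using diam ab by auto
  then show 3: "d a' b = d a b - 1" using a'(3)[OF ab(2)] by auto
  have "d b a = Suc (d b' a)" using b'(3)[OF ab(1)] \<open>a \<noteq> b\<close> by auto
  then show 4: "d b' a = d a b - 1" using 2 by simp
  then show 5: "d a b' = d a b - 1" using gdist_sym[OF ab(1) inner(2)] by simp
  have "b' \<noteq> a" using 5 diam ab by auto
  then have "d a b' = Suc (d a' b')" using a'(3)[OF inner(2)] by auto
  then show 6: "d a' b' = d a b - 2" using 5 by simp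
  then show "d b' a' = d a b - 2" using gdist_sym[OF inner] by simp
  show "d b a' = d a b - 1" using 3 gdist_sym[OF inner(1) ab(2)] by simp
qed

lemma distinct: "a \<noteq> b" "a \<noteq> a'" "a \<noteq> b'" "b \<noteq> a'" "b \<noteq> b'" "a' \<noteq> b'"
  using dist diam ab inner gdist_eq_0_iff[of a b] gdist_eq_0_iff[of a a'] gdist_eq_0_iff[of a b']
    gdist_eq_0_iff[of b a'] gdist_eq_0_iff[of b b'] gdist_eq_0_iff[of a' b'] by simp_all

lemma card_V: "2 \<le> card V"
  using card_mono[OF pair_finite_verts, of "{a, b}"] ab distinct(1) by simp

lemma eccentricity_end: "eccentricity G a = d a b" "eccentricity G a' = d a b - 1"
proof -
  show "eccentricity G a = d a b"
    by (rule eccentricityI[OF ab(2) refl]) (rule max[OF ab(1)])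
  show "eccentricity G a' = d a b - 1"
  proof (rule eccentricityI[OF ab(2) dist(4)])
    fix w assume w: "w \<in> V"
    show "d a' w \<le> d a b - 1"
    proof (cases "w = a")
      case True
      then show ?thesis using dist(1) diam gdist_sym[OF ab(1) inner(1)] by simp
    next
      case False
      then show ?thesis using a'(3)[OF w] max[OF ab(1) w] by simp
    qed
  qed
qed

lemma eccentricity:
  "eccentricity G a = d a b" "eccentricity G b = d a b"
  "eccentricity G a' = d a b - 1" "eccentricity G b' = d a b - 1"
  using eccentricity_end diametral_tree.eccentricity_end[OF swap] dist(3) by simp_all

text \<open>As the path has length at least 3, the distance 1 at either end stays below the smaller
  eccentricity \<open>d a b - 1\<close>, and the inner pair, at distance \<open>d a b - 2\<close>,
  misses it by one.\<close>

lemma entries: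
  "ecc_entry G a b = d a b" "ecc_entry G a b' = d a b - 1" "ecc_entry G a' b = d a b - 1"
  "ecc_entry G a' b' = 0" "ecc_entry G a a' = 0" "ecc_entry G b b' = 0"
  using dist diam by (auto simp: ecc_entry_def eccentricity)

lemma entries':
  "ecc_entry G b a = d a b" "ecc_entry G b' a = d a b - 1" "ecc_entry G b a' = d a b - 1"
  "ecc_entry G b' a' = 0" "ecc_entry G a' a = 0" "ecc_entry G b' b = 0"
  using entries ecc_entry_sym[OF ab(2,1)] ecc_entry_sym[OF inner(2) ab(1)] ecc_entry_sym[OF ab(2) inner(1)]
    ecc_entry_sym[OF inner(2,1)] ecc_entry_sym[OF inner(1) ab(1)] ecc_entry_sym[OF inner(2) ab(2)]
  by simp_all

text \<open>With \<open>D = d a b\<close>, the smaller quotient is 8/5 at \<open>D = 4\<close> but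
  drops to 1 at \<open>D = 3\<close>. There the path on four vertices, itself a broom, has second
  eigenvalue 1, so diameter 3 calls for additional leaves.\<close>

lemma ecc_eigval_ge_diameter_4:
  assumes "4 \<le> d a b"
  shows "10 / 9 \<le> ecc_eigval 2 G"
proof (rule ecc_eigval_ge_support[where S = "{a, a', b', b}"
      and x = "\<lambda>u. if u = a \<or> u = b then 1 else 0"
      and y = "\<lambda>u. if u = a then 1 else if u = b then - 1 else if u = a' then - 2 else if u = b' then 2 else 0",
      OF card_V])
qed (use assms ab inner distinct distinct[symmetric] in
  \<open>simp_all add: entries entries' ecc_entry_self of_nat_diff power2_eq_square\<close>)

end

section \<open>Trees of diameter 3\<close>

locale diameter_3_tree = diametral_tree +
  assumes diam_3: "d a b = 3"
begin

lemma swap_3: "diameter_3_tree G b a b' a'"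
  using swap diam_3 dist(3) by (simp add: diameter_3_tree_def diameter_3_tree_axioms_def)

lemma edge: "(a', b') \<in> parcs G"
  using dist(6) diam_3 inner gdist_eq_1_iff by simp

lemma arcs_ends: "(a, a') \<in> parcs G" "(b, b') \<in> parcs G"
  using a'(1) b'(1) arcs_symmetric by simp_all

lemma dist_3: "u \<in> V \<Longrightarrow> v \<in> V \<Longrightarrow> d u v \<le> 3"
  using max diam_3 by simp

lemma eccentricity_inner: "eccentricity G a' = 2" "eccentricity G b' = 2"
  using eccentricity diam_3 by simp_all

lemma eccentricity_leaf:
  assumes x: "(x, a') \<in> parcs G" "x \<noteq> b'"
  shows "eccentricity G x = 3"
proof (rule eccentricityI[OF ab(2)])
  show "d x b = 3"
    by (rule gdist_across[OF edge x arcs_ends(2) distinct(4)])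
qed (use dist_3 in_arcsD1[OF x(1)] in auto)

lemma entries_leaf:
  assumes x: "(x, a') \<in> parcs G" "x \<noteq> b'"
  shows "ecc_entry G x b' = 2" "ecc_entry G b' x = 2" "ecc_entry G x a' = 0" "ecc_entry G a' x = 0"
proof -
  have V: "x \<in> V" using in_arcsD1[OF x(1)] .
  have "d x b' = 2" using gdist_sides[OF edge x] gdist_sym[OF V inner(2)] by simp
  then show 1: "ecc_entry G x b' = 2"
    by (simp add: ecc_entry_def eccentricity_leaf[OF x] eccentricity_inner)
  have "d x a' = 1" using x(1) gdist_eq_1_iff[OF V inner(1)] by simp
  then show 2: "ecc_entry G x a' = 0"
    by (simp add: ecc_entry_def eccentricity_leaf[OF x] eccentricity_inner)
  show "ecc_entry G b' x = 2" "ecc_entry G a' x = 0"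
    using 1 2 ecc_entry_sym[OF V inner(2)] ecc_entry_sym[OF V inner(1)] by simp_all
qed

lemma entries_same_side:
  assumes x: "(x, a') \<in> parcs G" "x \<noteq> b'" and y: "(y, a') \<in> parcs G" "y \<noteq> b'"
  shows "ecc_entry G x y = 0"
proof -
  have V: "x \<in> V" "y \<in> V" using in_arcsD1 x y by auto
  have "d x a' = 1" using x(1) gdist_eq_1_iff[OF V(1) inner(1)] by simp
  then have "d x y \<le> 2" using gdist_step[OF V(1) arcs_symmetric[OF y(1)]] by simp
  then show ?thesis
    by (simp add: ecc_entry_def eccentricity_leaf[OF x] eccentricity_leaf[OF y])
qed

lemma entries_across:
  assumes x: "(x, a') \<in> parcs G" "x \<noteq> b'" and y: "(y, b') \<in> parcs G" "y \<noteq> a'"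
  shows "ecc_entry G x y = 3" "ecc_entry G y x = 3"
proof -
  have V: "x \<in> V" "y \<in> V" using in_arcsD1 x y by auto
  show 1: "ecc_entry G x y = 3"
    using gdist_across[OF edge x y] eccentricity_leaf[OF x] diameter_3_tree.eccentricity_leaf[OF swap_3 y]
    by (simp add: ecc_entry_def)
  then show "ecc_entry G y x = 3" using ecc_entry_sym[OF V] by simp
qed

text \<open>Values 1, 1 and -1, -1 on the leaves with -t and t on the centres have the quotient (8 t
  - 12) / (t^2 + 2), largest at t = (3 + sqrt 17) / 2 = 3.56.... The integer t = 4 gives 10/9,
  whereas t = 3 gives 12/11, which is below 4 / sqrt 13. The even vector, 1 on the four leaves, has
  quotient 6.\<close>

lemma ecc_eigval_ge_double_star:
  assumes u: "(u, a') \<in> parcs G" "u \<noteq> b'" "u \<noteq> a" and w: "(w, b') \<in> parcs G" "w \<noteq> a'" "w \<noteq> b"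
  shows "10 / 9 \<le> ecc_eigval 2 G"
proof -
  have V: "u \<in> V" "w \<in> V" using in_arcsD1 u w by auto
  have "u \<noteq> a'" "w \<noteq> b'" using u(1) w(1) no_loops' by auto
  \<comment> \<open>The distance to \<open>b'\<close> tells the leaves of the two sides apart, so
    that the six vertices are distinct.\<close>
  moreover have "d u b' = 2" "d w b' = 1" "d a b' = 2" "d b b' = 1"
    using gdist_sides[OF edge u(1,2)] gdist_sym[OF V(1) inner(2)] gdist_eq_1_iff[OF V(2) inner(2)] w(1)
      dist(2,5) diam_3 by simp_all
  ultimately have ne: "u \<noteq> a'" "w \<noteq> b'" "u \<noteq> w" "u \<noteq> b" "w \<noteq> a" by auto
  note ne = ne u(2,3) w(2,3) distinct
  note ea = arcs_ends(1) distinct(3) and eb = arcs_ends(2) distinct(4)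
  note D = diameter_3_tree.entries_leaf[OF swap_3] diameter_3_tree.entries_same_side[OF swap_3]
  note E = entries_leaf[OF ea] entries_leaf[OF u(1,2)] D(1-4)[OF eb] D(1-4)[OF w(1,2)]
    entries_same_side[OF ea u(1,2)] entries_same_side[OF u(1,2) ea]
    D(5)[OF eb w(1,2)] D(5)[OF w(1,2) eb]
    entries_across[OF ea eb] entries_across[OF ea w(1,2)] entries_across[OF u(1,2) eb]
    entries_across[OF u(1,2) w(1,2)] entries(4) entries'(4)
    ecc_entry_self[OF ab(1)] ecc_entry_self[OF ab(2)] ecc_entry_self[OF V(1)] ecc_entry_self[OF V(2)]
    ecc_entry_self[OF inner(1)] ecc_entry_self[OF inner(2)]
  define x :: "'a \<Rightarrow> real" where "x v = (if v \<in> {a, u, b, w} then 1 else 0)" for v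
  define y :: "'a \<Rightarrow> real" where "y v = (if v \<in> {a, u} then 1 else if v \<in> {b, w} then - 1
    else if v = a' then - 4 else if v = b' then 4 else 0)" for v
  have xy: "x a = 1" "x u = 1" "x a' = 0" "x b' = 0" "x b = 1" "x w = 1"
    "y a = 1" "y u = 1" "y a' = - 4" "y b' = 4" "y b = - 1" "y w = - 1"
    using ne ne[symmetric] by (simp_all add: x_def y_def)
  define S where "S = {a, u, a', b', b, w}"
  have sum_S: "sum f S = f a + f u + f a' + f b' + f b + f w" for f :: "'a \<Rightarrow> real"
    using ne ne[symmetric] by (simp add: S_def)
  show ?thesis
  proof (rule ecc_eigval_ge_support[where S = S and x = x and y = y, OF card_V])
    show "S \<subseteq> V" using ab inner V by (simp add: S_def)
    show "x v = 0" "y v = 0" if "v \<notin> S" for v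
      using that by (simp_all add: S_def x_def y_def)
  qed (simp_all add: sum_S xy E)
qed

text \<open>As no distance exceeds 3, every vertex is within 2 of both centres; the central edge
  makes the two distances differ, so the smaller is at most 1.\<close>

lemma verts_cases:
  assumes "u \<in> V"
  obtains "u = a'" | "u = b'" | "(u, a') \<in> parcs G" "u \<noteq> b'" | "(u, b') \<in> parcs G" "u \<noteq> a'"
proof -
  have "d u a' \<le> 2 \<and> d u b' \<le> 2"
  proof -
    have "d b u \<le> 3" "d a u \<le> 3" using dist_3 ab assms by auto
    then have "d a' u \<le> 2" if "u \<noteq> a" using a'(3)[OF assms that] by simp
    moreover have "d b' u \<le> 2" if "u \<noteq> b" using b'(3)[OF assms that] \<open>d b u \<le> 3\<close> by simp
    ultimately show ?thesis
      using dist(1,2) gdist_sym[OF assms inner(1)] gdist_sym[OF assms inner(2)]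
        gdist_sym[OF ab(1) inner(1)] gdist_sym[OF ab(2) inner(2)] by (cases "u = a"; cases "u = b") auto
  qed
  moreover have "d u a' \<noteq> d u b'" by (rule no_equal_levels[OF assms edge])
  ultimately have "d u a' \<le> 1 \<or> d u b' \<le> 1" by linarith
  then have "d u a' = 0 \<or> d u a' = 1 \<or> d u b' = 0 \<or> d u b' = 1" by linarith
  then show ?thesis
    using that gdist_eq_0_iff[OF assms inner(1)] gdist_eq_0_iff[OF assms inner(2)]
      gdist_eq_1_iff[OF assms inner(1)] gdist_eq_1_iff[OF assms inner(2)] by auto
qed

text \<open>The side with a single leaf becomes the long end: \<open>a\<close>, \<open>a'\<close>,
  \<open>b'\<close> turn into 0, 1, 2. The leaves at \<open>b'\<close>, among them \<open>b\<close>,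
  are interchangeable, so any bijection to the remaining numbers will do.\<close>

lemma broom_iso:
  assumes only: "\<And>u. (u, a') \<in> parcs G \<Longrightarrow> u \<noteq> b' \<Longrightarrow> u = a" and n: "4 \<le> card V"
  shows "digraph_iso (with_proj G) (with_proj (broom (card V)))"
proof -
  let ?n = "card V"
  define B where "B = {u. (u, b') \<in> parcs G \<and> u \<noteq> a'}"
  have BV: "B \<subseteq> V" using in_arcsD1 by (auto simp: B_def)
  have notB: "a \<notin> B" "a' \<notin> B" "b' \<notin> B"
    using dist(5) diam_3 gdist_eq_1_iff[OF ab(1) inner(2)] no_loops' by (auto simp: B_def)
  have V: "V = {a, a', b'} \<union> B"
    using ab inner BV only by (auto simp: B_def elim: verts_cases)
  have fB: "finite B" using BV pair_finite_verts finite_subset by blast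
  have "card V = 3 + card B"
    unfolding V using notB fB distinct by (subst card_Un_disjoint) auto
  then have "card B = card {3..<?n}" by simp
  then obtain g where g: "bij_betw g B {3..<?n}"
    using finite_same_card_bij[OF fB finite_atLeastLessThan] by blast
  define h where "h u = (if u = a then 0 else if u = a' then 1 else if u = b' then 2 else g u)" for u
  have h: "h a = 0" "h a' = 1" "h b' = 2" "\<And>u. u \<in> B \<Longrightarrow> h u = g u"
    using distinct notB by (auto simp: h_def)
  have hB: "h ` B = {3..<?n}"
    using h(4) g by (simp add: bij_betw_def cong: image_cong)
  have noBB: "(u, v) \<notin> parcs G" if "u \<in> B" "v \<in> B" for u v
  proof
    assume uv: "(u, v) \<in> parcs G"
    have "d b' u = 1" "d b' v = 1"
      using that BV gdist_eq_1_iff[OF inner(2)] arcs_symmetric by (auto simp: B_def)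
    then show False using no_equal_levels[OF inner(2) uv] by simp
  qed
  have arcs_sub: "(u, v) \<in> {(a, a'), (a', a), (a', b'), (b', a')} \<union> {b'} \<times> B \<union> B \<times> {b'}"
    if uv: "(u, v) \<in> parcs G" for u v
  proof -
    have "u \<in> {a, a', b'} \<union> B" "v \<in> {a, a', b'} \<union> B"
      using in_arcsD1[OF uv] in_arcsD2[OF uv] V by auto
    moreover have "u \<noteq> v" using no_loops' uv by auto
    moreover have "v = a'" if "u = a" using a'(2) arcs_symmetric uv that by simp
    moreover have "u = a'" if "v = a" using a'(2) uv that by simp
    moreover have "u = a \<or> u = b'" if "v = a'" using only uv that by blast
    moreover have "v = a \<or> v = b'" if "u = a'" using only[of v] arcs_symmetric[OF uv] that by blast
    moreover have "\<not> (u \<in> B \<and> v \<in> B)" using noBB uv by blast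
    ultimately show ?thesis using notB by auto
  qed
  have arcs: "parcs G = {(a, a'), (a', a), (a', b'), (b', a')} \<union> {b'} \<times> B \<union> B \<times> {b'}"
  proof
    show "parcs G \<subseteq> {(a, a'), (a', a), (a', b'), (b', a')} \<union> {b'} \<times> B \<union> B \<times> {b'}"
      using arcs_sub by (rule subrelI)
    show "{(a, a'), (a', a), (a', b'), (b', a')} \<union> {b'} \<times> B \<union> B \<times> {b'} \<subseteq> parcs G"
      using arcs_ends(1) edge arcs_symmetric by (auto simp: B_def)
  qed
  show ?thesis
  proof (rule digraph_isoI[where h = h])
    show "pair_wf_digraph G" ..
    have "inj_on h B"
      using g h(4) by (simp add: bij_betw_def cong: inj_on_cong)
    then show "inj_on h (pverts G)"
      unfolding V using h(1-3) hB distinct notB by (auto simp: inj_on_Un)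
    show "pverts (broom ?n) = h ` pverts G"
      using n h(1-3) hB unfolding V image_Un by (auto simp: broom_verts)
    have "map_prod h h ` parcs G
      = {(0, 1), (1, 0), (1, 2), (2, 1)} \<union> {2} \<times> {3..<?n} \<union> {3..<?n} \<times> {2}"
      unfolding arcs image_Un map_prod_surj_on[OF refl refl] hB by (simp add: h(1-3))
    also have "\<dots> = parcs (broom ?n)"
      by (auto simp: broom_arcs_iff[OF n])
    finally show "parcs (broom ?n) = map_prod h h ` parcs G" ..
  qed
qed

end

lemma (in utree) broom_or_ecc_eigval_ge:
  assumes n: "4 \<le> card V" and not_star: "\<not> complete_bipartite_digraph 1 (card V - 1) (with_proj G)"
  shows "digraph_iso (with_proj G) (with_proj (broom (card V))) \<or> 10 / 9 \<le> ecc_eigval 2 G"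
proof -
  obtain a b where ab: "a \<in> V" "b \<in> V" and max: "\<And>u v. u \<in> V \<Longrightarrow> v \<in> V \<Longrightarrow> d u v \<le> d a b"
    using diametral_pair by blast
  have diam: "3 \<le> d a b"
  proof (rule ccontr)
    assume "\<not> ?thesis"
    then have "d u v \<le> 2" if "u \<in> V" "v \<in> V" for u v
      using max[OF that] by linarith
    then show False
      using diameter_le_2_imp_star n not_star by simp
  qed
  have "a \<noteq> b" using diam ab by auto
  have max': "d u v \<le> d b a" if "u \<in> V" "v \<in> V" for u v
    using max[OF that] gdist_sym[OF ab] by simp
  obtain a' where "(a', a) \<in> parcs G \<and> (\<forall>w. (w, a) \<in> parcs G \<longrightarrow> w = a')
      \<and> (\<forall>u\<in>V. u \<noteq> a \<longrightarrow> d a u = Suc (d a' u))"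
    using diametral_end[OF ab \<open>a \<noteq> b\<close> max] by blast
  then have a': "(a', a) \<in> parcs G" "\<And>w. (w, a) \<in> parcs G \<Longrightarrow> w = a'"
      "\<And>u. u \<in> V \<Longrightarrow> u \<noteq> a \<Longrightarrow> d a u = Suc (d a' u)"
    by blast+
  obtain b' where "(b', b) \<in> parcs G \<and> (\<forall>w. (w, b) \<in> parcs G \<longrightarrow> w = b')
      \<and> (\<forall>u\<in>V. u \<noteq> b \<longrightarrow> d b u = Suc (d b' u))"
    using diametral_end[OF ab(2,1) \<open>a \<noteq> b\<close>[symmetric] max'] by blast
  then have b': "(b', b) \<in> parcs G" "\<And>w. (w, b) \<in> parcs G \<Longrightarrow> w = b'"
      "\<And>u. u \<in> V \<Longrightarrow> u \<noteq> b \<Longrightarrow> d b u = Suc (d b' u)"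
    by blast+
  interpret D: diametral_tree G a b a' b'
    by unfold_locales (fact ab max diam a' b')+
  show ?thesis
  proof (cases "d a b = 3")
    case False
    then have "4 \<le> d a b" using diam by linarith
    then show ?thesis using D.ecc_eigval_ge_diameter_4 by blast
  next
    case True
    interpret D: diameter_3_tree G a b a' b'
      by unfold_locales (fact True)
    \<comment> \<open>Either centre may be the one with a single leaf, so the isomorphism is needed
      for both orientations of the longest path.\<close>
    show ?thesis
      using D.broom_iso[OF _ n] diameter_3_tree.broom_iso[OF D.swap_3 _ n]
        D.ecc_eigval_ge_double_star by blast
  qed
qed

theorem theorem3p4:
  fixes T :: "'a pair_pre_digraph" and n :: nat
  assumes "undirected_tree T"
    and "card (pverts T) = n"
    and "n \<ge> 4"
    and "\<not> complete_bipartite_digraph 1 (n - 1) (with_proj T)"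
  shows "ecc_eigval 2 T \<ge> ecc_eigval 2 (broom n)
    \<and> (ecc_eigval 2 T = ecc_eigval 2 (broom n) \<longleftrightarrow> digraph_iso (with_proj T) (with_proj (broom n)))"
proof (cases "digraph_iso (with_proj T) (with_proj (broom n))")
  case True
  interpret utree T by (rule utreeI[OF assms(1)])
  obtain h where "inj_on h (pverts T)" "pverts (broom n) = h ` pverts T"
      "parcs (broom n) = map_prod h h ` parcs T"
    using digraph_isoE[OF True] .
  then have "ecc_eigval 2 T = ecc_eigval 2 (broom n)"
    using pair_wf_digraph_broom[OF assms(3)] pair_finite_verts by (intro ecc_eigval_iso) auto
  with True show ?thesis by simp
next
  case False
  interpret utree T by (rule utreeI[OF assms(1)])
  have "10 / 9 \<le> ecc_eigval 2 T"
    using broom_or_ecc_eigval_ge assms False by blast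
  \<comment> \<open>The strict bound for the broom also excludes equality here.\<close>
  then show ?thesis
    using ecc_eigval_broom_less[OF assms(3)] False by linarith
qed

end
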